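(* Let $G$ be a biconnected graph. Then: (1) $\mathrm{ch}(G)\le\max_{A\in\mathrm{Part}(G)}\mathrm{ch}(G(A))+2$. (2) $\mathrm{ch}(G)\le\max\bigl(3,\ \max_{A}\mathrm{ch}(G(A))+2\bigr)$, where the inner maximum ranges over the parts $A\in\mathrm{Part}(G)$ that are blocks.
   Context: All graphs are finite, undirected, without loops or multiple edges; $G(U)$ is the subgraph induced on $U$. The choice number $\mathrm{ch}(H)$ is the least $k$ such that for every assignment of lists of $k$ colors to the vertices of $H$ there is a proper coloring in which each vertex receives a color from its list. A connected component means the vertex set of a maximal connected subgraph. A set $R\subset V(G)$ is a cutset if $G-R$ (delete the vertices of $R$) is disconnected; $\mathfrak R_2(G)$ is the set of 2-vertex cutsets. $R$ separates $X$ from $Y$ (where $X,Y\not\subset R$) if no vertex of $X\setminus R$ and no vertex of $Y\setminus R$ lie in a common connected component of $G-R$; $R$ splits $X$ if $X\setminus R$ is not contained in one connected component of $G-R$. $G$ is $k$-connected if $v(G)>k$ and it has no cutset with at most $k-1$ vertices; biconnected = 2-connected, triconnected = 3-connected. Cutsets $S,T\in\mathfrak R_2(G)$ are independent if neither splits the other; $S$ is single if it is independent with all other cutsets in $\mathfrak R_2(G)$; $\mathfrak O(G)$ is the set of single cutsets. A set $A\subset V(G)$ is a part of $G$ if no cutset of $\mathfrak O(G)$ splits $A$ but every vertex outside $A$ is separated from $A$ by some cutset of $\mathfrak O(G)$; $\mathrm{Part}(G)$ is the set of parts. $G'$ is obtained from $G$ by adding all edges $ab$ with $\{a,b\}\in\mathfrak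 O(G)$. A part $A$ is a block if $G'(A)$ is triconnected. The maximum over an empty set is taken to be $-\infty$. *)

theory Defs
  imports "HOL-Library.Extended_Real" "Graph_Theory.Digraph_Component"
begin

text \<open>
  A finite simple undirected graph is a symmetric loop-free digraph without parallel arcs
  (\<^locale>\<open>graph\<close>, or \<^locale>\<open>pair_graph\<close> when arcs are pairs of vertices): an edge \<open>uv\<close> is
  the pair of opposite arcs between \<open>u\<close> and \<open>v\<close>.
\<close>

definition del_vertices :: "('a, 'b) pre_digraph \<Rightarrow> 'a set \<Rightarrow> ('a, 'b) pre_digraph" where
  "del_vertices G R = G \<restriction> (verts G - R)"

definition components :: "('a, 'b) pre_digraph \<Rightarrow> 'a set set" where
  "components G = verts ` {H. pre_digraph.max_subgraph G Digraph_Component.connected H}"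

text \<open>
  The graph without vertices is not connected in the sense of
  \<^const>\<open>Digraph_Component.connected\<close>. It does not count as disconnected either, so \<open>V(G)\<close>
  itself is not a cutset.
\<close>

definition cutset :: "('a, 'b) pre_digraph \<Rightarrow> 'a set \<Rightarrow> bool" where
  "cutset G R \<longleftrightarrow> R \<subseteq> verts G \<and> R \<noteq> verts G \<and> \<not> Digraph_Component.connected (del_vertices G R)"

definition k_connected :: "nat \<Rightarrow> ('a, 'b) pre_digraph \<Rightarrow> bool" where
  "k_connected k G \<longleftrightarrow> k < card (verts G) \<and> \<not> (\<exists>R. cutset G R \<and> card R < k)"

definition two_cutsets :: "('a, 'b) pre_digraph \<Rightarrow> 'a set set" where
  "two_cutsets G = {R. cutset G R \<and> card R = 2}"

definition separates :: "('a, 'b) pre_digraph \<Rightarrow> 'a set \<Rightarrow> 'a set \<Rightarrow> 'a set \<Rightarrow> bool" where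
  "separates G R X Y \<longleftrightarrow> \<not> X \<subseteq> R \<and> \<not> Y \<subseteq> R \<and>
     (\<forall>x \<in> X - R. \<forall>y \<in> Y - R. \<not> (\<exists>C \<in> components (del_vertices G R). x \<in> C \<and> y \<in> C))"

definition splits :: "('a, 'b) pre_digraph \<Rightarrow> 'a set \<Rightarrow> 'a set \<Rightarrow> bool" where
  "splits G R X \<longleftrightarrow> \<not> (\<exists>C \<in> components (del_vertices G R). X - R \<subseteq> C)"

definition independent_cutsets :: "('a, 'b) pre_digraph \<Rightarrow> 'a set \<Rightarrow> 'a set \<Rightarrow> bool" where
  "independent_cutsets G S T \<longleftrightarrow> \<not> splits G S T \<and> \<not> splits G T S"

definition single_cutsets :: "('a, 'b) pre_digraph \<Rightarrow> 'a set set" where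
  "single_cutsets G =
     {S \<in> two_cutsets G. \<forall>T \<in> two_cutsets G. T \<noteq> S \<longrightarrow> independent_cutsets G S T}"

definition parts :: "('a, 'b) pre_digraph \<Rightarrow> 'a set set" where
  "parts G = {A. A \<subseteq> verts G \<and> (\<forall>R \<in> single_cutsets G. \<not> splits G R A) \<and>
     (\<forall>x \<in> verts G - A. \<exists>R \<in> single_cutsets G. separates G R {x} A)}"

definition add_single_edges :: "'a pair_pre_digraph \<Rightarrow> 'a pair_pre_digraph" where
  "add_single_edges G =
     G\<lparr>parcs := parcs G \<union> {(a, b). {a, b} \<in> single_cutsets (with_proj G)}\<rparr>"

definition blocks :: "'a pair_pre_digraph \<Rightarrow> 'a set set" where
  "blocks G =
     {A \<in> parts (with_proj G). k_connected 3 (with_proj (add_single_edges G) \<restriction> A)}"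

definition proper_coloring :: "('a, 'b) pre_digraph \<Rightarrow> ('a \<Rightarrow> 'c) \<Rightarrow> bool" where
  "proper_coloring H c \<longleftrightarrow> (\<forall>e \<in> arcs H. c (tail H e) \<noteq> c (head H e))"

text \<open>
  Colors are natural numbers. For finite graphs this is no restriction, since only finitely many
  colors occur in a list assignment. Finiteness of the lists is explicit because infinite sets
  have cardinality \<open>0\<close>.
\<close>

definition choosable :: "('a, 'b) pre_digraph \<Rightarrow> nat \<Rightarrow> bool" where
  "choosable H k \<longleftrightarrow>
     (\<forall>L :: 'a \<Rightarrow> nat set. (\<forall>v \<in> verts H. finite (L v) \<and> card (L v) = k) \<longrightarrow>
       (\<exists>c. (\<forall>v \<in> verts H. c v \<in> L v) \<and> proper_coloring H c))"

definition choice_number :: "('a, 'b) pre_digraph \<Rightarrow> nat" where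
  "choice_number H = (LEAST k. choosable H k)"

text \<open>The maximum is taken in \<^typ>\<open>ereal\<close>, where the supremum of the empty set is \<open>-\<infinity>\<close>.\<close>

definition max_choice_number :: "('a, 'b) pre_digraph \<Rightarrow> 'a set set \<Rightarrow> ereal" where
  "max_choice_number G \<A> = (SUP A \<in> \<A>. ereal (real (choice_number (G \<restriction> A))))"

end

theory Submission
  imports Defs
begin

text \<open>
  Single cutsets never cross, so the components left by them form a laminar family. Coloring
  therefore proceeds through nested parts: color a cutset \<open>S\<close>, extend the coloring to the part next
  to \<open>S\<close> inside a component of \<open>G - S\<close>, and continue with the smaller components cut off by the
  single cutsets of that part. In each step only the two vertices of \<open>S\<close> are precolored, and
  deleting their colors from the lists costs at most two colors per vertex.

  If such a part \<open>A\<close> is not a block and has more than three vertices, then every two-vertex cutset of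
  \<open>G'(A)\<close> is crossed by another one, which forces \<open>G'(A)\<close> to have maximum degree two; lists of three
  colors then suffice for a greedy extension.
\<close>

section \<open>Two-vertex cutsets of a biconnected graph\<close>

text \<open>Everything is stated for a bare symmetric relation because the theory is applied twice:
  to G, and, for a part \<open>A\<close> that is not a block, to G'(A). A two-vertex cutset of G'(A)
  turns out to be a cutset of G that splits \<open>A\<close>; a part is split by no single cutset,
  so this one is not single, and that is where the cutset crossing it comes from. The main obstacle
  is that components left by different single cutsets can overlap when together they cover the whole
  graph. Fixing one component of \<open>G - S\<close> and nesting all further ones inside it leaves
  a vertex outside all of them, which excludes this case. The 3 in the second bound is the degree
  bound plus one: the precolored cutset lies in \<open>A\<close>, so its vertices are already
  counted among the at most two neighbors and cost no further colors. Parts with at most three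
  vertices have degrees at most two for trivial reasons.\<close>

locale biconnected_rel =
  fixes V :: "'a set" and E :: "'a rel"
  assumes finite_V: "finite V"
    and sym_E: "sym E"
    and irrefl_E: "(x, x) \<notin> E"
    and E_subset: "E \<subseteq> V \<times> V"
    and small_not_cut: "R \<subseteq> V \<Longrightarrow> card R < 2 \<Longrightarrow> x \<in> V - R \<Longrightarrow> y \<in> V - R \<Longrightarrow>
      (x, y) \<in> rtrancl_on (V - R) E"
begin

definition reach :: "'a set \<Rightarrow> 'a \<Rightarrow> 'a \<Rightarrow> bool" where
  "reach R x y \<longleftrightarrow> (x, y) \<in> rtrancl_on (V - R) E"

definition comp_of :: "'a set \<Rightarrow> 'a \<Rightarrow> 'a set" where
  "comp_of R x = {y. reach R x y}"

definition cut :: "'a set \<Rightarrow> bool" where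
  "cut R \<longleftrightarrow> R \<subseteq> V \<and> card R = 2 \<and> (\<exists>x \<in> V - R. \<exists>y \<in> V - R. \<not> reach R x y)"

definition splitting :: "'a set \<Rightarrow> 'a set \<Rightarrow> bool" where
  "splitting R X \<longleftrightarrow> (\<exists>x \<in> X - R. \<exists>y \<in> X - R. \<not> reach R x y)"

text \<open>\<open>T\<close> may also be \<open>S\<close> itself; this agrees with the usual notion
  because \<open>S - S\<close> is empty, so no set splits itself.\<close>

definition single :: "'a set \<Rightarrow> bool" where
  "single S \<longleftrightarrow> cut S \<and> (\<forall>T. cut T \<longrightarrow> \<not> splitting S T \<and> \<not> splitting T S)"

lemma E_symD: "(x, y) \<in> E \<Longrightarrow> (y, x) \<in> E"
  using sym_E by (rule symD)

lemma E_in: "(x, y) \<in> E \<Longrightarrow> x \<in> V" "(x, y) \<in> E \<Longrightarrow> y \<in> V"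
  using E_subset by auto

lemma finite_nbrs: "finite (E `` A)"
  by (rule finite_subset[OF _ finite_V]) (auto dest: E_in)

lemma reach_in: "reach R x y \<Longrightarrow> x \<in> V - R" "reach R x y \<Longrightarrow> y \<in> V - R"
  unfolding reach_def by (rule in_rtrancl_on_in_F, assumption)+

lemma reach_refl: "x \<in> V - R \<Longrightarrow> reach R x x"
  unfolding reach_def by (rule rtrancl_on_refl)

lemma reach_sym: "reach R x y \<Longrightarrow> reach R y x"
  unfolding reach_def by (rule symD[OF rtrancl_on_sym[OF sym_E]])

lemma reach_trans: "reach R x y \<Longrightarrow> reach R y z \<Longrightarrow> reach R x z"
  unfolding reach_def by (rule rtrancl_on_trans)

lemma reach_step: "reach R x y \<Longrightarrow> (y, z) \<in> E \<Longrightarrow> z \<notin> R \<Longrightarrow> reach R x z"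
  unfolding reach_def by (auto intro: rtrancl_on_into_rtrancl_on dest: E_in)

lemma reach_edge: "(x, y) \<in> E \<Longrightarrow> x \<notin> R \<Longrightarrow> y \<notin> R \<Longrightarrow> reach R x y"
  by (meson DiffI E_in(1) reach_refl reach_step)

lemma reach_induct [consumes 1, case_names base step]:
  assumes "reach R x y" and "P x"
    and "\<And>y z. reach R x y \<Longrightarrow> (y, z) \<in> E \<Longrightarrow> z \<in> V - R \<Longrightarrow> P y \<Longrightarrow> P z"
  shows "P y"
  using assms(1)[unfolded reach_def]
  by (induct rule: rtrancl_on_induct) (auto intro: assms simp: reach_def)

lemma comp_subset: "comp_of R x \<subseteq> V - R"
  by (auto simp: comp_of_def dest: reach_in)

lemma finite_comp: "finite (comp_of R x)"
  using comp_subset finite_V by (meson finite_Diff finite_subset)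

lemma comp_self: "x \<in> V - R \<Longrightarrow> x \<in> comp_of R x"
  by (simp add: comp_of_def reach_refl)

lemma comp_eq: "y \<in> comp_of R x \<Longrightarrow> comp_of R y = comp_of R x"
  unfolding comp_of_def by (blast intro: reach_trans reach_sym)

lemma comp_disjoint: "comp_of R x = comp_of R y \<or> comp_of R x \<inter> comp_of R y = {}"
  using comp_eq by blast

lemma comp_closed: "y \<in> comp_of R x \<Longrightarrow> (y, z) \<in> E \<Longrightarrow> z \<in> comp_of R x \<union> R"
  unfolding comp_of_def by (blast intro: reach_step)

lemma cutD: "cut R \<Longrightarrow> R \<subseteq> V" "cut R \<Longrightarrow> card R = 2"
  by (auto simp: cut_def)

lemma finite_cut: "cut R \<Longrightarrow> finite R"
  using cutD finite_V finite_subset by blast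

lemma cut_not_reach: "cut R \<Longrightarrow> \<exists>z \<in> V - R. \<not> reach R x z"
  unfolding cut_def by (metis reach_sym reach_trans)

lemma cut_not_subset: "cut R \<Longrightarrow> cut T \<Longrightarrow> R \<noteq> T \<Longrightarrow> \<not> R \<subseteq> T"
  by (metis card_subset_eq cutD(2) finite_cut)

text \<open>A walk avoiding \<open>R\<close> never leaves the component of \<open>x\<close>, and
  that component misses \<open>Q\<close>.\<close>

lemma reach_avoid:
  assumes "reach R x y" and "comp_of R x \<inter> Q = {}"
  shows "reach Q x y"
  using assms(1)
proof (induct rule: reach_induct)
  case base
  with assms show ?case by (metis Diff_iff comp_self disjoint_iff reach_in(1) reach_refl)
next
  case (step y z)
  then have "z \<in> comp_of R x" by (auto simp: comp_of_def intro: reach_step)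
  with step assms(2) show ?case by (blast intro: reach_step)
qed

text \<open>Deleting only the other vertex of \<open>R\<close> does not disconnect the graph, so
  \<open>x\<close> reaches \<open>r\<close>; just before the first entry into \<open>r\<close> the
  walk is still in the component of \<open>x\<close>.\<close>

lemma reach_boundary:
  assumes "cut R" and "x \<in> V - R" and "r \<in> R"
  obtains y where "y \<in> comp_of R x" and "(y, r) \<in> E"
proof (rule ccontr)
  assume "\<not> thesis"
  with that have no: "(y, r) \<notin> E" if "reach R x y" for y
    using \<open>reach R x y\<close> by (auto simp: comp_of_def)
  have "card (R - {r}) < 2"
    using assms cutD finite_cut by (simp add: card_Diff_singleton)
  moreover have "R - {r} \<subseteq> V" "x \<in> V - (R - {r})" "r \<in> V - (R - {r})"
    using assms cutD by auto
  ultimately have "reach (R - {r}) x r"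
    unfolding reach_def by (intro small_not_cut)
  then have "reach R x r"
  proof (induct rule: reach_induct)
    case base
    show ?case using assms reach_refl by blast
  next
    case (step y z)
    with no show ?case by (metis Diff_iff reach_step singletonD)
  qed
  then show False using assms reach_in by blast
qed

text \<open>The main tool for comparing two cutsets: a component of \<open>V - R\<close> is attached
  to every vertex of \<open>R\<close>, so one that misses \<open>Q\<close> provides a route to
  \<open>r\<close> that misses \<open>Q\<close> as well.\<close>

lemma reach_through:
  assumes "cut R" and "x \<in> V - R" and "comp_of R x \<inter> Q = {}" and "r \<in> R - Q"
  shows "reach Q x r"
proof -
  obtain y where y: "y \<in> comp_of R x" "(y, r) \<in> E" using reach_boundary assms by blast
  then have "reach Q x y" using assms reach_avoid unfolding comp_of_def by blast
  then show ?thesis using y assms reach_step by blast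
qed

section \<open>Crossing pairs of cutsets\<close>

lemma splitting_pair:
  assumes "cut T" and "splitting R T"
  obtains a b where "T = {a, b}" "a \<noteq> b" "a \<notin> R" "b \<notin> R" "\<not> reach R a b"
proof -
  obtain a b where ab: "a \<in> T - R" "b \<in> T - R" "\<not> reach R a b"
    using assms splitting_def by blast
  then have "a \<noteq> b" using assms cutD reach_refl by blast
  then have "T = {a, b}" using ab assms cutD(2)[of T] by (auto simp: card_2_iff)
  then show thesis using that ab \<open>a \<noteq> b\<close> by blast
qed

text \<open>If \<open>T\<close> left \<open>R\<close> together, some component of
  \<open>V - T\<close> would miss \<open>R\<close>; being attached to both vertices of
  \<open>T\<close>, it would link them without meeting \<open>R\<close>.\<close>

lemma splitting_sym:
  assumes "cut R" and "cut T" and "splitting R T"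
  shows "splitting T R"
proof (rule ccontr)
  assume nsplit: "\<not> splitting T R"
  obtain a b where ab: "T = {a, b}" "a \<notin> R" "b \<notin> R" "\<not> reach R a b"
    using splitting_pair assms by metis
  then have disj: "R \<inter> T = {}" by blast
  obtain r where "r \<in> R" using assms cutD by fastforce
  obtain d where d: "d \<in> V - T" "\<not> reach T r d" using cut_not_reach assms by blast
  have "u \<notin> comp_of T d" if "u \<in> R" for u
  proof
    assume "u \<in> comp_of T d"
    then have "reach T u d" unfolding comp_of_def by (simp add: reach_sym)
    moreover have "reach T r u" using nsplit disj that \<open>r \<in> R\<close> unfolding splitting_def by blast
    ultimately show False using d reach_trans by blast
  qed
  then have "comp_of T d \<inter> R = {}" by blast
  then have "reach R d a" "reach R d b"
    using reach_through assms d ab by blast+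
  with ab show False using reach_sym reach_trans by blast
qed

text \<open>A component missing \<open>T\<close> would link all vertices of \<open>R - T\<close> to
  each other without meeting \<open>T\<close>.\<close>

lemma splitting_meets_comp:
  assumes "cut R" and "cut T" and "splitting T R" and "x \<in> V - R"
  shows "comp_of R x \<inter> T \<noteq> {}"
proof
  assume "comp_of R x \<inter> T = {}"
  then have "reach T x r" if "r \<in> R - T" for r
    using reach_through assms that by blast
  then show False using assms(3) unfolding splitting_def by (meson reach_sym reach_trans)
qed


end

section \<open>All two-vertex cutsets crossed\<close>

text \<open>Cycles of length at least four are the models to keep in mind. Triconnected graphs
  satisfy the assumption vacuously, so the degree bounds below start from some
  \<open>cut R\<close>.\<close>

locale crossed_rel = biconnected_rel +
  assumes crossed: "cut R \<Longrightarrow> \<exists>T. cut T \<and> splitting R T"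
begin

lemma crossed_non_adjacent:
  assumes "cut {a, b}"
  shows "(a, b) \<notin> E"
proof
  assume ab: "(a, b) \<in> E"
  obtain T where T: "cut T" "splitting {a, b} T" using crossed assms by blast
  then have "splitting T {a, b}" using splitting_sym assms by blast
  then show False
    unfolding splitting_def using ab E_symD reach_edge reach_refl E_in
    by (metis DiffE DiffI insertE singletonD)
qed

text \<open>A crossing cutset has a vertex in every component of \<open>V - R\<close>, and it has
  only two vertices.\<close>

lemma crossed_two_comps:
  assumes "cut R" and "x \<in> V - R" "y \<in> V - R" "z \<in> V - R"
    and "\<not> reach R x y" "\<not> reach R x z"
  shows "reach R y z"
proof (rule ccontr)
  assume "\<not> reach R y z"
  obtain T where T: "cut T" "splitting R T" using crossed assms by blast
  have "comp_of R u \<inter> T \<noteq> {}" if "u \<in> V - R" for u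
    using splitting_meets_comp splitting_sym assms(1) T that by blast
  then obtain a b c where "a \<in> comp_of R x \<inter> T" "b \<in> comp_of R y \<inter> T" "c \<in> comp_of R z \<inter> T"
    using assms by (metis ex_in_conv)
  moreover from this have "a \<noteq> b" "a \<noteq> c" "b \<noteq> c"
    using assms(5,6) \<open>\<not> reach R y z\<close> reach_sym reach_trans
    unfolding comp_of_def Int_iff mem_Collect_eq by metis+
  ultimately have "card {a, b, c} = 3" "{a, b, c} \<subseteq> T" by auto
  then have "3 \<le> card T" using T finite_cut card_mono by metis
  then show False using T cutD by fastforce
qed

text \<open>
  A component of \<open>G - R\<close> is the interior of a path joining the two vertices of \<open>R\<close>: a cutset
  crossing \<open>R\<close> has a vertex \<open>t\<close> in the component, and \<open>t\<close> cuts it into smaller components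
  belonging to the cutsets \<open>{r, t}\<close> with \<open>r \<in> R\<close>.
\<close>

lemma crossed_comp_degree:
  assumes "cut R" and "x \<in> V - R"
  shows "(\<forall>v \<in> comp_of R x. card (E `` {v}) \<le> 2) \<and> (\<forall>r \<in> R. card (E `` {r} \<inter> comp_of R x) \<le> 1)"
  using assms
proof (induct "card (comp_of R x)" arbitrary: R x rule: less_induct)
  case less
  let ?C = "comp_of R x"
  obtain T where T: "cut T" "splitting R T" using crossed less.prems by blast
  have TR: "splitting T R" using splitting_sym T less.prems by blast
  obtain t where t: "t \<in> ?C" "t \<in> T"
    using splitting_meets_comp less.prems T TR by blast
  have tR: "t \<notin> R" using t comp_subset by blast
  obtain t' where t': "T = {t, t'}" "t' \<notin> R" "t' \<notin> ?C" "t' \<noteq> t"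
  proof -
    obtain a b where ab: "T = {a, b}" "a \<noteq> b" "a \<notin> R" "b \<notin> R" "\<not> reach R a b"
      by (rule splitting_pair[OF T])
    have "\<not> (a \<in> ?C \<and> b \<in> ?C)"
      using ab(5) reach_sym reach_trans unfolding comp_of_def by blast
    then show thesis using that[of a] that[of b] ab t by auto
  qed
  have t'V: "t' \<in> V" using T t' cutD by blast
  define D where "D r = ?C \<inter> comp_of T r" for r
  \<comment> \<open>The claim is used for both vertices of \<open>R\<close>. Adding \<open>r\<close>
    to \<open>D r\<close> accounts for a possible edge between \<open>t\<close> and
    \<open>r\<close>, so each side contributes at most one neighbor of \<open>t\<close>.\<close>
  have side: "(\<forall>v \<in> D r. card (E `` {v}) \<le> 2) \<and> card (E `` {t} \<inter> (D r \<union> {r})) \<le> 1 \<and>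
      card (E `` {r} \<inter> ?C) \<le> 1" if R: "R = {r, s}" and nr: "\<not> reach T r s" and rsT: "r \<notin> T" "s \<notin> T" for r s
  proof -
    have rV: "r \<in> V" "s \<in> V" using R less.prems cutD by auto
    have nbr: "E `` {r} \<inter> ?C \<subseteq> D r \<union> {t}"
    proof
      fix u assume u: "u \<in> E `` {r} \<inter> ?C"
      then have "u \<in> comp_of T r" if "u \<noteq> t"
        using that t' rsT by (auto simp: comp_of_def intro: reach_edge)
      with u show "u \<in> D r \<union> {t}" unfolding D_def by blast
    qed
    show ?thesis
    proof (cases "D r = {}")
      case True
      have "card (E `` {t} \<inter> (D r \<union> {r})) \<le> card {r}" "card (E `` {r} \<inter> ?C) \<le> card {t}"
        using True nbr by (intro card_mono; auto)+
      then show ?thesis using True by (simp del: Int_insert_right)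
    next
      case False
      then obtain y where y: "y \<in> D r" by blast
      let ?Q = "{r, t}"
      have D_sub: "D r \<subseteq> V - ?Q" unfolding D_def
        using comp_subset[of R x] comp_subset[of T r] t R by blast
      have in_D: "comp_of ?Q u \<subseteq> D r" if u: "u \<in> D r" for u
      proof
        fix w assume "w \<in> comp_of ?Q u"
        then have "reach ?Q u w" by (simp add: comp_of_def)
        then show "w \<in> D r"
        proof (induct rule: reach_induct)
          case base show ?case by (rule u)
        next
          case (step a b)
          have a: "a \<in> ?C" "a \<in> comp_of T r" using step unfolding D_def by auto
          have b: "b \<in> ?C \<or> b \<in> R" "b \<in> comp_of T r \<or> b \<in> T"
            using comp_closed a step by blast+
          have "b \<noteq> s" using b(2) nr rsT unfolding comp_of_def by blast
          then have "b \<in> ?C" using b(1) R step by blast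
          moreover from this have "b \<notin> T" using t' step by blast
          ultimately show ?case using b unfolding D_def by blast
        qed
      qed
      have t'Q: "t' \<in> V - ?Q" using t' t'V R by auto
      have far: "\<not> reach ?Q u t'" if "u \<in> D r" for u
        using in_D[OF that] t' unfolding D_def comp_of_def by blast
      have "r \<noteq> t" using R tR by blast
      have cutQ: "cut ?Q" unfolding cut_def
        using far[OF y] y D_sub t'Q \<open>r \<noteq> t\<close> rV t comp_subset by fastforce
      \<comment> \<open>At most two components remain after deleting \<open>?Q\<close>, and
        \<open>t'\<close> lies in one of them; hence \<open>D r\<close> is all of the other, and the
        induction hypothesis speaks about it.\<close>
      have eq: "comp_of ?Q y = D r"
      proof
        show "comp_of ?Q y \<subseteq> D r" using in_D y by blast
        have "reach ?Q y z" if "z \<in> D r" for z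
          using crossed_two_comps[OF cutQ t'Q, of y z] far y that D_sub reach_sym by blast
        then show "D r \<subseteq> comp_of ?Q y" by (auto simp: comp_of_def)
      qed
      have "D r \<subset> ?C" using t t' unfolding D_def comp_of_def by (auto dest: reach_in)
      then have "card (comp_of ?Q y) < card ?C"
        unfolding eq by (rule psubset_card_mono[OF finite_comp])
      from less.hyps[OF this cutQ] y D_sub eq
      have IH: "\<forall>v \<in> D r. card (E `` {v}) \<le> 2" "card (E `` {r} \<inter> D r) \<le> 1" "card (E `` {t} \<inter> D r) \<le> 1"
        by auto
      \<comment> \<open>With this edge excluded, the neighbors counted for \<open>t\<close> and for
        \<open>r\<close> all lie in \<open>D r\<close>.\<close>
      have "(r, t) \<notin> E" using crossed_non_adjacent cutQ by blast
      then have "E `` {t} \<inter> (D r \<union> {r}) = E `` {t} \<inter> D r" "E `` {r} \<inter> ?C \<subseteq> E `` {r} \<inter> D r"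
        using nbr E_symD by auto
      moreover from this(2) have "card (E `` {r} \<inter> ?C) \<le> card (E `` {r} \<inter> D r)"
        by (intro card_mono) (simp_all add: finite_nbrs)
      ultimately show ?thesis using IH by simp
    qed
  qed
  obtain r s where rs: "R = {r, s}" "r \<notin> T" "s \<notin> T" "\<not> reach T r s"
    using splitting_pair[OF less.prems(1) TR] by metis
  have r_side: "(\<forall>v \<in> D r. card (E `` {v}) \<le> 2) \<and> card (E `` {t} \<inter> (D r \<union> {r})) \<le> 1 \<and>
      card (E `` {r} \<inter> ?C) \<le> 1" by (rule side[of r s]) (use rs in auto)
  have s_side: "(\<forall>v \<in> D s. card (E `` {v}) \<le> 2) \<and> card (E `` {t} \<inter> (D s \<union> {s})) \<le> 1 \<and>
      card (E `` {s} \<inter> ?C) \<le> 1" by (rule side[of s r]) (use rs reach_sym in auto)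
  have C: "?C \<subseteq> {t} \<union> D r \<union> D s"
  proof
    fix y assume y: "y \<in> ?C"
    show "y \<in> {t} \<union> D r \<union> D s"
    proof (cases "y = t")
      case False
      then have "y \<in> V - T" using y t' comp_subset by blast
      then have "comp_of T y \<inter> R \<noteq> {}" using splitting_meets_comp T less.prems by blast
      then show ?thesis using y rs unfolding D_def comp_of_def by (auto intro: reach_sym)
    qed simp
  qed
  have "E `` {t} \<subseteq> (E `` {t} \<inter> (D r \<union> {r})) \<union> (E `` {t} \<inter> (D s \<union> {s}))"
    using comp_closed[OF t(1)] C rs irrefl_E by blast
  then have "card (E `` {t}) \<le> card ((E `` {t} \<inter> (D r \<union> {r})) \<union> (E `` {t} \<inter> (D s \<union> {s})))"
    by (intro card_mono) (auto intro: finite_nbrs)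
  also have "\<dots> \<le> 1 + 1"
    using r_side s_side by (intro order_trans[OF card_Un_le] add_mono) auto
  finally show ?case using C r_side s_side rs by auto
qed

text \<open>Vertices outside \<open>R\<close> are covered by the component bound. A vertex of
  \<open>R\<close> is not adjacent to the other one, because \<open>T\<close> separates them, and
  every component of \<open>V - R\<close> contains one of the two vertices of \<open>T\<close>; so
  there are at most two components, each with at most one neighbor.\<close>

lemma crossed_degree:
  assumes "cut R"
  shows "card (E `` {v}) \<le> 2"
proof -
  obtain T where T: "cut T" "splitting R T" using crossed assms by blast
  have TR: "splitting T R" using splitting_sym T assms by blast
  consider "v \<notin> V" | "v \<in> V - R" | "v \<in> R" by blast
  then show ?thesis
  proof cases
    case 1
    then have "E `` {v} = {}" using E_in by blast
    then show ?thesis by simp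
  next
    case 2
    then show ?thesis using crossed_comp_degree assms comp_self by blast
  next
    case 3
    obtain a b where ab: "T = {a, b}" "a \<notin> R" "b \<notin> R" using splitting_pair[OF T] by metis
    then have abV: "a \<in> V - R" "b \<in> V - R" using T cutD by auto
    obtain r s where rs: "R = {r, s}" "\<not> reach T r s" "r \<notin> T" "s \<notin> T"
      using splitting_pair[OF assms TR] by metis
    have "E `` {v} \<subseteq> (E `` {v} \<inter> comp_of R a) \<union> (E `` {v} \<inter> comp_of R b)"
    proof
      fix u assume u: "u \<in> E `` {v}"
      have "u \<notin> R"
      proof
        assume "u \<in> R"
        with u 3 rs irrefl_E have "(r, s) \<in> E" using E_symD by auto
        then show False using rs reach_edge by blast
      qed
      then have "u \<in> V - R" using u E_in by blast
      then have "comp_of R u \<inter> T \<noteq> {}" using splitting_meets_comp assms T TR by blast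
      then show "u \<in> (E `` {v} \<inter> comp_of R a) \<union> (E `` {v} \<inter> comp_of R b)"
        using u ab by (auto simp: comp_of_def intro: reach_sym)
    qed
    then have "card (E `` {v}) \<le> card ((E `` {v} \<inter> comp_of R a) \<union> (E `` {v} \<inter> comp_of R b))"
      by (intro card_mono) (auto intro: finite_nbrs)
    also have "\<dots> \<le> 1 + 1"
      using crossed_comp_degree[OF assms] abV 3 
      by (intro order_trans[OF card_Un_le] add_mono) auto
    finally show ?thesis by simp
  qed
qed

end

section \<open>Parts\<close>

context biconnected_rel
begin

text \<open>Stronger than being a part: the separating cutsets are required to lie inside \<open>A\<close>.\<close>

definition tight_part :: "'a set \<Rightarrow> bool" where
  "tight_part A \<longleftrightarrow> A \<subseteq> V \<and> (\<forall>R. single R \<longrightarrow> \<not> splitting R A) \<and>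
     (\<forall>x \<in> V - A. \<exists>R. single R \<and> R \<subseteq> A \<and> \<not> A \<subseteq> R \<and> x \<notin> R \<and> comp_of R x \<inter> A = {})"

lemma singleD:
  assumes "single S"
  shows "cut S" and "cut T \<Longrightarrow> \<not> splitting S T" and "cut T \<Longrightarrow> \<not> splitting T S"
  using assms by (auto simp: single_def)

lemma single_reach:
  assumes "single S" and "cut T" and "a \<in> S - T" "b \<in> S - T"
  shows "reach T a b"
  using assms singleD(3) unfolding splitting_def by blast

text \<open>Every vertex of the component reaches \<open>t\<close> through the component, which
  misses \<open>T\<close>.\<close>

lemma comp_of_nested:
  assumes "single S" and "single T" and "y \<in> V - S" and "comp_of S y \<inter> T = {}" and "t \<in> S - T"
  shows "comp_of S y \<subseteq> comp_of T t"
proof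
  fix z assume z: "z \<in> comp_of S y"
  then have "comp_of S z \<inter> T = {}" "z \<in> V - S"
    using assms comp_eq comp_subset by blast+
  then have "reach T z t" using reach_through assms singleD by blast
  then show "z \<in> comp_of T t" by (simp add: comp_of_def reach_sym)
qed

section \<open>Laminarity of the components left by single cutsets\<close>

definition fragments :: "'a set set" where
  "fragments = {D. \<exists>S x. single S \<and> x \<in> V - S \<and> D = comp_of S x}"

lemma finite_fragments: "finite fragments"
  by (rule finite_subset[of _ "Pow V"]) (auto simp: fragments_def finite_V dest: comp_subset[THEN subsetD])

text \<open>The vertex \<open>z\<close> excludes the one bad configuration, where the components
  overlap and, together with \<open>S\<close> and \<open>T\<close>, cover \<open>V\<close>. The
  third alternative also keeps each component away from the cutset of the other.\<close>

lemma fragments_laminar: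
  assumes S: "single S" "x \<in> V - S" and T: "single T" "y \<in> V - T"
    and z: "z \<in> V" "z \<notin> comp_of S x \<union> S" "z \<notin> comp_of T y \<union> T"
  shows "comp_of S x \<subseteq> comp_of T y \<or> comp_of T y \<subseteq> comp_of S x \<or>
    comp_of S x \<inter> (comp_of T y \<union> T) = {} \<and> comp_of T y \<inter> S = {}"
proof (cases "S = T")
  case True
  then have "comp_of S x = comp_of T y \<or> comp_of S x \<inter> comp_of T y = {}"
    using True comp_disjoint by simp
  moreover have "comp_of S x \<inter> T = {}" "comp_of T y \<inter> S = {}" using True comp_subset by blast+
  ultimately show ?thesis by blast
next
  case False
  then obtain s t where s: "s \<in> S - T" and t: "t \<in> T - S"
    using cut_not_subset S T singleD(1) by blast
  have S_all: "comp_of T s' = comp_of T s" if "s' \<in> S - T" for s'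
    using single_reach S T singleD(1) that s comp_eq by (simp add: comp_of_def)
  have T_all: "comp_of S t' = comp_of S t" if "t' \<in> T - S" for t'
    using single_reach S T singleD(1) that t comp_eq by (simp add: comp_of_def)
  consider "comp_of S x \<inter> T = {}" "comp_of T y \<inter> S = {}"
    | "comp_of S x \<inter> T = {}" "comp_of T y \<inter> S \<noteq> {}"
    | "comp_of S x \<inter> T \<noteq> {}" "comp_of T y \<inter> S = {}"
    | "comp_of S x \<inter> T \<noteq> {}" "comp_of T y \<inter> S \<noteq> {}" by blast
  then show ?thesis
  proof cases
    case 1
    then have "comp_of S x \<subseteq> comp_of T s" using comp_of_nested S T s by blast
    moreover have "comp_of T s = comp_of T y \<or> comp_of T s \<inter> comp_of T y = {}"
      by (rule comp_disjoint)
    ultimately have "comp_of S x \<subseteq> comp_of T y \<or> comp_of S x \<inter> comp_of T y = {}" by blast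
    then show ?thesis using 1 by blast
  next
    case 2
    then obtain s' where "s' \<in> comp_of T y" "s' \<in> S - T" using comp_subset by blast
    then have "comp_of T y = comp_of T s'" using comp_eq by simp
    then show ?thesis using comp_of_nested[OF S(1) T(1) S(2) 2(1)] \<open>s' \<in> S - T\<close> by blast
  next
    case 3
    then obtain t' where "t' \<in> comp_of S x" "t' \<in> T - S" using comp_subset by blast
    then have "comp_of S x = comp_of S t'" using comp_eq by simp
    then show ?thesis using comp_of_nested[OF T(1) S(1) T(2) 3(2)] \<open>t' \<in> T - S\<close> by blast
  next
    \<comment> \<open>Each component contains what the other cutset has outside its own. The
      component of \<open>z\<close> in \<open>V - S\<close> then misses \<open>T\<close>, so it is
      nested in \<open>comp_of T y\<close>, against the choice of \<open>z\<close>.\<close>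
    case 4
    then obtain s' t' where "s' \<in> comp_of T y" "s' \<in> S - T" "t' \<in> comp_of S x" "t' \<in> T - S"
      using comp_subset by blast
    then have eq: "comp_of T y = comp_of T s" "comp_of S x = comp_of S t"
      using comp_eq S_all T_all by metis+
    have "z \<in> V - S" using z by blast
    moreover have "comp_of S z \<inter> T = {}"
    proof (rule ccontr)
      assume "comp_of S z \<inter> T \<noteq> {}"
      then obtain u where "u \<in> comp_of S z" "u \<in> T - S" using comp_subset by blast
      then have "comp_of S z = comp_of S x" using eq T_all comp_eq by metis
      then show False using z comp_self \<open>z \<in> V - S\<close> by blast
    qed
    ultimately have "comp_of S z \<subseteq> comp_of T s" using comp_of_nested S T s by blast
    then show ?thesis using z comp_self \<open>z \<in> V - S\<close> eq by blast
  qed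
qed

text \<open>\<open>M\<close> consists of the maximal fragments strictly inside \<open>comp_of S x\<close>.\<close>

lemma fragment_decomposition:
  assumes S: "single S" and x: "x \<in> V - S"
  obtains A M where "tight_part A" "S \<subseteq> A" "comp_of S x \<union> S = A \<union> \<Union>M" "A \<inter> \<Union>M = {}"
    and "\<And>D D'. D \<in> M \<Longrightarrow> D' \<in> M \<Longrightarrow> D \<noteq> D' \<Longrightarrow> D \<inter> D' = {}"
    and "\<And>D. D \<in> M \<Longrightarrow> D \<subset> comp_of S x \<and> (\<exists>T y. single T \<and> T \<subseteq> A \<and> y \<in> V - T \<and> D = comp_of T y)"
proof -
  let ?C = "comp_of S x"
  have cS: "cut S" using S singleD by blast
  \<comment> \<open>This is the outer vertex required for laminarity: the fragments inside
    \<open>?C\<close> and their cutsets all stay within \<open>?C \<union> S\<close>.\<close>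
  obtain z where z: "z \<in> V - S" "\<not> reach S x z" using cut_not_reach cS by blast
  have zC: "z \<notin> ?C \<union> S" using z by (auto simp: comp_of_def)
  define F where "F = {D \<in> fragments. D \<subset> ?C}"
  define M where "M = {D \<in> F. \<forall>D' \<in> F. D \<subseteq> D' \<longrightarrow> D' = D}"
  define A where "A = (?C \<union> S) - \<Union>M"
  have "finite F" unfolding F_def using finite_fragments by simp
  have below_M: "\<exists>D' \<in> M. D \<subseteq> D'" if DF: "D \<in> F" for D
  proof -
    obtain D' where D': "D' \<in> F" "D \<subseteq> D'" "\<forall>D'' \<in> F. D' \<subseteq> D'' \<longrightarrow> D' = D''"
      using finite_has_maximal2[OF \<open>finite F\<close> DF] by blast
    have "D' \<in> M" unfolding M_def mem_Collect_eq using D'(1,3) by metis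
    then show ?thesis using D'(2) by blast
  qed
  have M_frag: "\<exists>T y. single T \<and> y \<in> V - T \<and> D = comp_of T y" and M_sub: "D \<subset> ?C" if "D \<in> M" for D
    using that unfolding M_def F_def fragments_def by blast+
  have M_max: "\<not> D \<subseteq> D'" if "D \<in> M" "D' \<in> M" "D \<noteq> D'" for D D'
    using that unfolding M_def by blast
  have frag_cut: "T \<noteq> S \<and> T \<subseteq> ?C \<union> S" if T: "single T" "y \<in> V - T" "comp_of T y \<subset> ?C" for T y
  proof
    show "T \<noteq> S"
    proof
      assume "T = S"
      then have "comp_of S y = ?C" using T comp_self comp_eq by blast
      then show False using T \<open>T = S\<close> by blast
    qed
    show "T \<subseteq> ?C \<union> S"
    proof
      fix t assume "t \<in> T"
      then obtain u where "u \<in> comp_of T y" "(u, t) \<in> E"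
        using reach_boundary T singleD(1) by blast
      then show "t \<in> ?C \<union> S" using T comp_closed by blast
    qed
  qed
  \<comment> \<open>Maximality rules out both inclusions. Disjointness from \<open>T'\<close> is
    recorded too, because it keeps the cutsets in \<open>A\<close> when the fragments are
    removed.\<close>
  have M_disj: "comp_of T y \<inter> (comp_of T' y' \<union> T') = {}"
    if D: "single T" "y \<in> V - T" "comp_of T y \<in> M" and D': "single T'" "y' \<in> V - T'" "comp_of T' y' \<in> M"
      and ne: "comp_of T y \<noteq> comp_of T' y'" for T y T' y'
  proof -
    have "\<not> comp_of T y \<subseteq> comp_of T' y'" "\<not> comp_of T' y' \<subseteq> comp_of T y"
      using M_max D(3) D'(3) ne by metis+
    moreover have "z \<notin> comp_of T y \<union> T" "z \<notin> comp_of T' y' \<union> T'"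
      using zC frag_cut[OF D(1,2) M_sub[OF D(3)]] M_sub[OF D(3)]
        frag_cut[OF D'(1,2) M_sub[OF D'(3)]] M_sub[OF D'(3)] by blast+
    ultimately show ?thesis using fragments_laminar[OF D(1,2) D'(1,2)] z by blast
  qed
  have SA: "S \<subseteq> A" unfolding A_def using M_sub comp_subset by blast
  have TA: "T \<subseteq> A" if T: "single T" "y \<in> V - T" "comp_of T y \<in> M" for T y
  proof -
    have "T \<inter> D = {}" if DM: "D \<in> M" for D
    proof (cases "D = comp_of T y")
      case True
      then show ?thesis using comp_subset by blast
    next
      case False
      obtain T' y' where T': "single T'" "y' \<in> V - T'" "D = comp_of T' y'" using M_frag[OF DM] by blast
      then have "D \<inter> (comp_of T y \<union> T) = {}" using M_disj[of T' y' T y] T DM False by simp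
      then show ?thesis by blast
    qed
    then show ?thesis unfolding A_def using frag_cut[OF T(1,2) M_sub[OF T(3)]] by blast
  qed
  have AV: "A \<subseteq> V" unfolding A_def using comp_subset cutD cS by blast
  have unsplit: "\<not> splitting R A" if R: "single R" for R
  proof (cases "R = S")
    case True
    have "reach S x a" if "a \<in> A - S" for a using that unfolding A_def comp_of_def by blast
    then show ?thesis unfolding True splitting_def by (meson reach_sym reach_trans)
  next
    case False
    have cR: "cut R" using R singleD by blast
    have "\<exists>p. \<forall>a \<in> A - R. reach R a p"
    proof (cases "R \<inter> ?C = {}")
      case True
      obtain s where s: "s \<in> S - R" using cut_not_subset cS cR False by blast
      have "reach R a s" if a: "a \<in> A - R" for a
      proof (cases "a \<in> S")
        case True
        then show ?thesis using single_reach S cR s a by blast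
      next
        case False
        then have "a \<in> ?C" using a unfolding A_def by blast
        then have "a \<in> V - S" "comp_of S a \<inter> R = {}" using comp_subset comp_eq \<open>R \<inter> ?C = {}\<close> by blast+
        then show ?thesis using reach_through cS s by blast
      qed
      then show ?thesis by blast
    next
      case crossing: False
      then obtain r where r: "r \<in> R" "r \<in> ?C" by blast
      have rS: "r \<in> R - S" using r comp_subset by blast
      obtain s where s: "s \<in> S - R" using cut_not_subset cS cR False by blast
      \<comment> \<open>Otherwise the component of \<open>a\<close> misses \<open>S\<close> and is
        nested in \<open>?C\<close>, properly because it omits \<open>r\<close>; so it lies in a
        maximal fragment and \<open>a\<close> would have been removed from \<open>A\<close>.\<close>
      have "reach R a s" if a: "a \<in> A - R" for a
      proof (rule ccontr)
        assume n: "\<not> reach R a s"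
        let ?D = "comp_of R a"
        have aV: "a \<in> V - R" using a AV by blast
        have "?D \<inter> S = {}"
        proof (rule ccontr)
          assume "?D \<inter> S \<noteq> {}"
          then obtain s' where "reach R a s'" "s' \<in> S" by (auto simp: comp_of_def)
          moreover then have "reach R s' s" using single_reach S cR s reach_in by blast
          ultimately show False using n reach_trans by blast
        qed
        then have "?D \<subseteq> comp_of S r" using comp_of_nested R S aV rS by blast
        also have "comp_of S r = ?C" using comp_eq r by blast
        finally have "?D \<subset> ?C" using r comp_subset by blast
        then have "?D \<in> F" unfolding F_def fragments_def using R aV by blast
        then show False using below_M comp_self aV a unfolding A_def by blast
      qed
      then show ?thesis by blast
    qed
    then show ?thesis unfolding splitting_def by (meson reach_sym reach_trans)
  qed
  \<comment> \<open>If the fragments used up \<open>?C\<close>, the one around \<open>x\<close>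
    would still leave a vertex of its cutset \<open>T \<noteq> S\<close> in \<open>A\<close> outside
    \<open>S\<close>.\<close>
  have "\<exists>a. a \<in> ?C \<inter> A"
  proof (rule ccontr)
    assume none: "\<nexists>a. a \<in> ?C \<inter> A"
    then obtain D where D: "D \<in> M" "x \<in> D" unfolding A_def using comp_self x by blast
    then obtain T y where T: "single T" "y \<in> V - T" "D = comp_of T y" using M_frag by blast
    then have T': "T \<noteq> S \<and> T \<subseteq> ?C \<union> S" "T \<subseteq> A"
      using frag_cut[OF T(1,2)] TA[OF T(1,2)] M_sub[OF D(1)] D(1) by simp_all
    then obtain t where "t \<in> T - S" using cut_not_subset T(1) cS singleD(1) by blast
    then show False using none T' by blast
  qed
  then have A_not_S: "\<not> A \<subseteq> S" using comp_subset by blast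
  have tight: "tight_part A"
    unfolding tight_part_def
  proof (intro conjI ballI)
    show "A \<subseteq> V" by (rule AV)
    show "\<forall>R. single R \<longrightarrow> \<not> splitting R A" using unsplit by blast
    fix v assume v: "v \<in> V - A"
    show "\<exists>R. single R \<and> R \<subseteq> A \<and> \<not> A \<subseteq> R \<and> v \<notin> R \<and> comp_of R v \<inter> A = {}"
    \<comment> \<open>Inside \<open>?C\<close> the cutset of the maximal fragment around
      \<open>v\<close> separates, outside it \<open>S\<close> does.\<close>
    proof (cases "v \<in> ?C")
      case True
      then obtain D where D: "D \<in> M" "v \<in> D" using v unfolding A_def by blast
      then obtain T y where T: "single T" "y \<in> V - T" "D = comp_of T y" using M_frag by blast
      then have "T \<noteq> S" using frag_cut[OF T(1,2)] M_sub[OF D(1)] by simp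
      then have "\<not> A \<subseteq> T" using SA cut_not_subset cS T singleD(1) by blast
      moreover have "comp_of T v = D" using D(2) T(3) comp_eq by simp
      moreover have "v \<notin> T" using D(2) T(3) comp_subset by blast
      moreover have "D \<inter> A = {}" unfolding A_def using D by blast
      moreover have "T \<subseteq> A" using TA[OF T(1,2)] T(3) D(1) by simp
      ultimately show ?thesis using T(1) by blast
    next
      case False
      then have "v \<in> V - S" using v SA by blast
      moreover have "comp_of S v \<inter> ?C = {}"
        using False \<open>v \<in> V - S\<close> comp_self comp_eq by (metis disjoint_iff)
      then have "comp_of S v \<inter> A = {}" unfolding A_def using comp_subset by blast
      ultimately show ?thesis using S SA A_not_S by blast
    qed
  qed
  have union: "?C \<union> S = A \<union> \<Union>M" unfolding A_def using M_sub by blast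
  have outside: "A \<inter> \<Union>M = {}" unfolding A_def by blast
  have disjoint: "D \<inter> D' = {}" if DM: "D \<in> M" "D' \<in> M" "D \<noteq> D'" for D D'
  proof -
    obtain T y T' y' where "single T" "y \<in> V - T" "D = comp_of T y"
      "single T'" "y' \<in> V - T'" "D' = comp_of T' y'"
      using M_frag[OF DM(1)] M_frag[OF DM(2)] by blast
    then have "D \<inter> (D' \<union> T') = {}" using M_disj[of T y T' y'] DM by simp
    then show ?thesis by blast
  qed
  have inner: "D \<subset> ?C \<and> (\<exists>T y. single T \<and> T \<subseteq> A \<and> y \<in> V - T \<and> D = comp_of T y)" if DM: "D \<in> M" for D
  proof -
    obtain T y where T: "single T" "y \<in> V - T" "D = comp_of T y" using M_frag[OF DM] by blast
    then have "T \<subseteq> A" using TA[OF T(1,2)] DM by simp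
    with T M_sub[OF DM] show ?thesis by blast
  qed
  show thesis using tight SA union outside disjoint inner by (rule that)
qed

lemma tight_part_verts: "(\<And>S. \<not> single S) \<Longrightarrow> tight_part V"
  by (simp add: tight_part_def)

text \<open>Keeps the maximum over all parts from being \<open>-\<infinity>\<close>, and yields that
  at least two colors are available.\<close>

lemma ex_tight_part: "\<exists>A. tight_part A"
proof (cases "\<exists>S. single S")
  case True
  then obtain S where S: "single S" by blast
  then obtain x where "x \<in> V - S" using singleD(1) cut_def by blast
  with S show ?thesis using fragment_decomposition by metis
next
  case False
  then show ?thesis using tight_part_verts by blast
qed

section \<open>Parts that are not blocks\<close>

text \<open>The edge relation of G'(A).\<close>

definition part_edges :: "'a set \<Rightarrow> 'a rel" where
  "part_edges A = {(a, b) \<in> A \<times> A. (a, b) \<in> E \<or> single {a, b}}"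

definition part_reach :: "'a set \<Rightarrow> 'a set \<Rightarrow> 'a \<Rightarrow> 'a \<Rightarrow> bool" where
  "part_reach A R x y \<longleftrightarrow> (x, y) \<in> rtrancl_on (A - R) (part_edges A)"

lemma part_reach_step:
  "part_reach A R x y \<Longrightarrow> z \<in> A - R \<Longrightarrow> (y, z) \<in> E \<or> single {y, z} \<Longrightarrow> part_reach A R x z"
  unfolding part_reach_def
  by (rule rtrancl_on_into_rtrancl_on) (auto simp: part_edges_def dest: in_rtrancl_on_in_F)

text \<open>A walk outside \<open>A\<close> returns through a single cutset
  \<open>Q \<subseteq> A\<close> that cuts off its current vertex, and it also entered through
  \<open>Q\<close>. It comes back either to a vertex already reached or to the other vertex of
  \<open>Q\<close>, and then the added edge replaces the detour.\<close>

lemma reach_imp_part_reach: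
  assumes A: "tight_part A" and "reach R x y" and "x \<in> A" and "y \<in> A"
  shows "part_reach A R x y"
proof -
  \<comment> \<open>Outside \<open>A\<close> the invariant covers every \<open>Q\<close> cutting off
    the current vertex, because the one used for the return is not known on leaving
    \<open>A\<close>.\<close>
  have "(y \<in> A \<longrightarrow> part_reach A R x y) \<and>
    (y \<notin> A \<longrightarrow> (\<forall>Q. single Q \<and> Q \<subseteq> A \<and> comp_of Q y \<inter> A = {} \<longrightarrow> (\<exists>q \<in> Q - R. part_reach A R x q)))"
    using assms(2)
  proof (induct rule: reach_induct)
    case base
    then show ?case using assms reach_in unfolding part_reach_def by auto
  next
    case (step y z)
    have yV: "y \<in> V" "y \<notin> R" using step reach_in by blast+
    show ?case
    proof (cases "z \<in> A"; cases "y \<in> A")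
      assume "z \<in> A" "y \<in> A"
      then show ?thesis using step part_reach_step by blast
    next
      assume zy: "z \<in> A" "y \<notin> A"
      then obtain Q where Q: "single Q" "Q \<subseteq> A" "y \<notin> Q" "comp_of Q y \<inter> A = {}"
        using A yV unfolding tight_part_def by blast
      then obtain q where q: "q \<in> Q - R" "part_reach A R x q" using step zy by blast
      have "z \<in> comp_of Q y \<union> Q" using comp_closed comp_self Q yV step by blast
      then have "z \<in> Q" using Q zy by blast
      show ?thesis
      proof (cases "z = q")
        case False
        have "card Q = 2" using Q singleD(1) cutD by blast
        then have "Q = {q, z}" using False q \<open>z \<in> Q\<close> by (auto simp: card_2_iff)
        then have "part_reach A R x z" using part_reach_step[OF q(2)] step(3) zy Q(1) by simp
        then show ?thesis using zy by simp
      qed (use q zy in blast)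
    next
      assume zy: "z \<notin> A" "y \<in> A"
      have "y \<in> Q - R" if Q: "single Q" "Q \<subseteq> A" "comp_of Q z \<inter> A = {}" for Q
      proof -
        have "z \<notin> Q" using Q zy by blast
        then have "y \<in> comp_of Q z \<union> Q" using comp_closed comp_self step E_symD by blast
        then show ?thesis using Q zy yV by blast
      qed
      then show ?thesis using step zy by blast
    next
      assume zy: "z \<notin> A" "y \<notin> A"
      have "comp_of Q y = comp_of Q z" if Q: "Q \<subseteq> A" for Q
      proof -
        have "z \<in> comp_of Q y" unfolding comp_of_def using reach_edge step zy Q by blast
        then show ?thesis using comp_eq by simp
      qed
      then show ?thesis using step zy by auto
    qed
  qed
  then show ?thesis using assms by blast
qed

text \<open>An added edge joins the two vertices of a single cutset. \<open>R\<close> does not split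
  it, so a path of \<open>G - R\<close> can stand in for the edge.\<close>

lemma part_reach_imp_reach:
  assumes A: "A \<subseteq> V" and R: "cut R" and "part_reach A R x y"
  shows "reach R x y"
  using assms(3) unfolding part_reach_def
proof (induct rule: rtrancl_on_induct)
  case base
  then show ?case using A reach_refl by blast
next
  case (step y z)
  then consider "(y, z) \<in> E" | "single {y, z}" unfolding part_edges_def by blast
  then show ?case
  proof cases
    case 2
    then have "reach R y z" using step single_reach R by blast
    then show ?thesis using step reach_trans by blast
  qed (use step reach_step in blast)
qed

text \<open>A vertex \<open>t\<close> of \<open>T\<close> outside \<open>A\<close> is cut off by a
  single \<open>Q \<subseteq> A\<close>. Since \<open>Q\<close> does not split \<open>T\<close>, the
  rest of \<open>T\<close> is in \<open>Q\<close> or beside \<open>t\<close>, so the components of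
  \<open>V - Q\<close> that meet \<open>A\<close> miss \<open>T\<close>. Through them and through
  \<open>Q\<close> all of \<open>R - T\<close> stays linked, and \<open>T\<close> does not split
  \<open>R\<close>.\<close>

lemma crossing_cut_subset:
  assumes A: "tight_part A" and R: "R \<subseteq> A" "cut R" and T: "cut T" "splitting T R"
  shows "T \<subseteq> A"
proof
  fix t assume "t \<in> T"
  show "t \<in> A"
  proof (rule ccontr)
    assume "t \<notin> A"
    moreover have "t \<in> V" using \<open>t \<in> T\<close> T cutD by blast
    ultimately obtain Q where Q: "single Q" "Q \<subseteq> A" "t \<notin> Q" "comp_of Q t \<inter> A = {}"
      using A unfolding tight_part_def by blast
    have cQ: "cut Q" using Q singleD by blast
    obtain q where q: "q \<in> Q - T" using cut_not_subset cQ T Q \<open>t \<in> T\<close> by blast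
    have "reach T r q" if r: "r \<in> R - T" for r
    proof (cases "r \<in> Q")
      case True
      then show ?thesis using single_reach Q T q r by blast
    next
      case False
      then have rV: "r \<in> V - Q" using r R cutD by blast
      have "comp_of Q r \<inter> T = {}"
      proof (rule ccontr)
        assume "comp_of Q r \<inter> T \<noteq> {}"
        then obtain t' where t': "reach Q r t'" "t' \<in> T" by (auto simp: comp_of_def)
        have "\<not> splitting Q T" using singleD(2) Q T by blast
        then have "reach Q t' t" using t' \<open>t \<in> T\<close> Q(3) reach_in(2) unfolding splitting_def by blast
        then have "r \<in> comp_of Q t" using t' unfolding comp_of_def by (blast intro: reach_sym reach_trans)
        then show False using Q r R by blast
      qed
      then show ?thesis using reach_through cQ rV q by blast
    qed
    then show False using T unfolding splitting_def by (meson reach_sym reach_trans)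
  qed
qed

text \<open>The cutset crossing a cutset of G'(A) is found in G. It lies in \<open>A\<close>, and it
  still crosses in G'(A) because reachability there implies reachability in G. The degree bound for
  G'(A) then passes to its subgraph G(A).\<close>

lemma non_block_degree:
  assumes A: "tight_part A" and R: "R \<subseteq> A" "card R < 3"
    and xy: "x \<in> A - R" "y \<in> A - R" "\<not> part_reach A R x y" and v: "v \<in> A"
  shows "card (E `` {v} \<inter> A) \<le> 2"
proof -
  have AV: "A \<subseteq> V" using A tight_part_def by blast
  \<comment> \<open>G'(A) inherits from G that fewer than two deleted vertices never disconnect
    it.\<close>
  have small: "part_reach A Q u w" if "Q \<subseteq> A" "card Q < 2" "u \<in> A - Q" "w \<in> A - Q" for Q u w
  proof (rule reach_imp_part_reach[OF A])
    show "reach Q u w" unfolding reach_def by (rule small_not_cut) (use that AV in auto)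
  qed (use that in auto)
  interpret H: biconnected_rel A "part_edges A"
  proof unfold_locales
    show "finite A" using AV finite_V finite_subset by blast
    show "sym (part_edges A)" unfolding part_edges_def by (auto intro!: symI dest: E_symD simp: insert_commute)
    show "(u, u) \<notin> part_edges A" for u
      using irrefl_E singleD(1)[of "{u, u}"] cutD(2)[of "{u, u}"] by (auto simp: part_edges_def)
    show "part_edges A \<subseteq> A \<times> A" by (auto simp: part_edges_def)
  qed (use small part_reach_def in blast)
  have H_reach: "H.reach = part_reach A"
    by (intro ext) (simp add: H.reach_def part_reach_def)
  have H_cut: "cut Q \<and> splitting Q A" if "H.cut Q" for Q
  proof -
    obtain u w where uw: "u \<in> A - Q" "w \<in> A - Q" "\<not> part_reach A Q u w"
      using \<open>H.cut Q\<close> H.cut_def H_reach by auto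
    then have "\<not> reach Q u w" using reach_imp_part_reach A by blast
    then show ?thesis
      using uw AV H.cutD[OF \<open>H.cut Q\<close>] unfolding cut_def splitting_def by blast
  qed
  interpret H: crossed_rel A "part_edges A"
  proof
    fix Q assume HQ: "H.cut Q"
    then have Q: "cut Q" "splitting Q A" "Q \<subseteq> A" using H_cut H.cutD by blast+
    then have "\<not> single Q" using A unfolding tight_part_def by blast
    then obtain T where T: "cut T" "splitting T Q" "splitting Q T" using Q splitting_sym unfolding single_def by blast
    have TA: "T \<subseteq> A" using crossing_cut_subset[OF A Q(3,1) T(1,2)] .
    obtain a b where ab: "T = {a, b}" "a \<notin> Q" "b \<notin> Q" "\<not> reach Q a b"
      using splitting_pair[OF T(1,3)] by metis
    obtain r s where rs: "Q = {r, s}" "r \<notin> T" "s \<notin> T" "\<not> reach T r s"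
      using splitting_pair[OF Q(1) T(2)] by metis
    have nr: "\<not> part_reach A T r s" "\<not> part_reach A Q a b"
      using part_reach_imp_reach AV Q T ab rs by blast+
    then have "H.cut T" unfolding H.cut_def H_reach using TA T cutD rs Q by auto
    moreover have "H.splitting Q T" unfolding H.splitting_def H_reach using ab nr by blast
    ultimately show "\<exists>T. H.cut T \<and> H.splitting Q T" by blast
  qed
  have "\<not> card R < 2" using small xy R by blast
  then have "H.cut R" unfolding H.cut_def H_reach using R xy by auto
  have "card (E `` {v} \<inter> A) \<le> card (part_edges A `` {v})" if "v \<in> A"
    using that by (intro card_mono H.finite_nbrs) (auto simp: part_edges_def)
  then show ?thesis using v H.crossed_degree[OF \<open>H.cut R\<close>, of v] by linarith
qed

end

section \<open>List colorings\<close>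

context biconnected_rel
begin

definition proper_on :: "'a set \<Rightarrow> ('a \<Rightarrow> nat) \<Rightarrow> bool" where
  "proper_on A c \<longleftrightarrow> (\<forall>x \<in> A. \<forall>y \<in> A. (x, y) \<in> E \<longrightarrow> c x \<noteq> c y)"

text \<open>The colors given on \<open>S\<close> need not come from the lists, and \<open>S\<close>
  may lie inside or outside \<open>A\<close>: this fits a part containing its cutset as well as a
  fragment disjoint from it.\<close>

definition extendable :: "('a \<Rightarrow> nat set) \<Rightarrow> 'a set \<Rightarrow> 'a set \<Rightarrow> bool" where
  "extendable L S A \<longleftrightarrow> (\<forall>c. proper_on S c \<longrightarrow>
     (\<exists>c'. (\<forall>v \<in> S. c' v = c v) \<and> (\<forall>v \<in> A - S. c' v \<in> L v) \<and> proper_on (A \<union> S) c'))"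

definition list_colorable :: "'a set \<Rightarrow> nat \<Rightarrow> bool" where
  "list_colorable A k \<longleftrightarrow> (\<forall>L :: 'a \<Rightarrow> nat set. (\<forall>v \<in> A. finite (L v) \<and> card (L v) = k) \<longrightarrow>
     (\<exists>c. (\<forall>v \<in> A. c v \<in> L v) \<and> proper_on A c))"

text \<open>Colored neighbors, those in \<open>S\<close> included, are always fewer than the colors
  in the list, so any order of coloring succeeds.\<close>

lemma greedy_extendable:
  assumes "finite A" and "\<forall>v \<in> A. finite (L v) \<and> card (E `` {v} \<inter> (A \<union> S)) < card (L v)"
  shows "extendable L S A"
  using assms
proof (induct A)
  case empty
  then show ?case by (auto simp: extendable_def)
next
  case (insert a A)
  have le: "card (E `` {v} \<inter> (A \<union> S)) \<le> card (E `` {v} \<inter> (insert a A \<union> S))" for v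
    by (intro card_mono) (auto intro: finite_nbrs)
  have IH: "extendable L S A"
    using insert.hyps(3) insert.prems le by (meson insertCI le_less_trans)
  show ?case
    unfolding extendable_def
  proof (intro allI impI)
    fix c assume "proper_on S c"
    then obtain c' where c': "\<forall>v \<in> S. c' v = c v" "\<forall>v \<in> A - S. c' v \<in> L v" "proper_on (A \<union> S) c'"
      using IH unfolding extendable_def by blast
    show "\<exists>c'. (\<forall>v \<in> S. c' v = c v) \<and> (\<forall>v \<in> insert a A - S. c' v \<in> L v) \<and> proper_on (insert a A \<union> S) c'"
    proof (cases "a \<in> S")
      case True
      then show ?thesis using c' by (intro exI[of _ c']) (auto simp: insert_absorb)
    next
      case False
      let ?N = "E `` {a} \<inter> (A \<union> S)"
      have "card (c' ` ?N) < card (L a)"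
        using card_image_le[of ?N c'] le[of a] insert.prems finite_nbrs
        by (meson finite_Int insertI1 le_less_trans)
      then obtain q where q: "q \<in> L a" "q \<notin> c' ` ?N"
        using insert.prems finite_nbrs
        by (metis card_mono finite_Int finite_imageI leD subsetI)
      have "proper_on (insert a A \<union> S) (c'(a := q))"
        using c'(3) q irrefl_E E_symD unfolding proper_on_def by auto
      then show ?thesis using c' q False insert.hyps(2) by (intro exI[of _ "c'(a := q)"]) auto
    qed
  qed
qed

lemma list_colorable_extendable:
  assumes A: "list_colorable A k" and S: "finite S" "card S \<le> 2"
    and L: "\<forall>v \<in> A. finite (L v) \<and> k + 2 \<le> card (L v)"
  shows "extendable L S A"
  unfolding extendable_def
proof (intro allI impI)
  fix c assume c: "proper_on S c"
  \<comment> \<open>Lists of size exactly \<open>k\<close> are required on all of \<open>A\<close>.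
    On \<open>S\<close> they are unconstrained, since the coloring obtained from them is discarded
    there.\<close>
  have "\<exists>K. finite K \<and> card K = k \<and> (v \<notin> S \<longrightarrow> K \<subseteq> L v - c ` S)" if "v \<in> A" for v
  proof -
    have "card (L v) - card (c ` S) \<le> card (L v - c ` S)"
      by (intro diff_card_le_card_Diff finite_imageI S)
    moreover have "card (c ` S) \<le> 2" using card_image_le[OF S(1)] S(2) le_trans by blast
    ultimately have "k \<le> card (L v - c ` S)" using L that by fastforce
    then show ?thesis using L that by (metis finite_Diff finite_subset obtain_subset_with_card_n)
  qed
  then obtain K where K: "\<forall>v \<in> A. finite (K v) \<and> card (K v) = k \<and> (v \<notin> S \<longrightarrow> K v \<subseteq> L v - c ` S)"
    by metis
  then obtain d where d: "\<forall>v \<in> A. d v \<in> K v" "proper_on A d"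
    using A unfolding list_colorable_def by metis
  let ?c = "\<lambda>v. if v \<in> S then c v else d v"
  have new: "d v \<in> L v" "d v \<notin> c ` S" if "v \<in> A" "v \<notin> S" for v
    using d(1) K that by blast+
  have "proper_on (A \<union> S) ?c"
    using c d(2) new(2) unfolding proper_on_def by (auto simp: image_iff) metis+
  then show "\<exists>c'. (\<forall>v \<in> S. c' v = c v) \<and> (\<forall>v \<in> A - S. c' v \<in> L v) \<and> proper_on (A \<union> S) c'"
    using new(1) by (intro exI[of _ ?c]) auto
qed

text \<open>All neighbors of a piece \<open>D\<close> outside \<open>D\<close> lie in
  \<open>A\<close>, so no edge joins two pieces and each can be colored independently from
  \<open>cA\<close>.\<close>

lemma glue_colorings:
  assumes cA: "proper_on A cA"
    and disj: "\<And>D D'. D \<in> M \<Longrightarrow> D' \<in> M \<Longrightarrow> D \<noteq> D' \<Longrightarrow> D \<inter> D' = {}"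
    and D: "\<And>D. D \<in> M \<Longrightarrow> A \<inter> D = {} \<and> (\<exists>T \<subseteq> A. E `` D \<subseteq> D \<union> T \<and> extendable L T D)"
  obtains c where "proper_on (A \<union> \<Union>M) c" "\<forall>v \<in> A. c v = cA v" "\<forall>v \<in> \<Union>M. c v \<in> L v"
proof -
  have "\<exists>d. (\<forall>v \<in> D. d v \<in> L v) \<and> (\<forall>v \<in> A \<inter> E `` D. d v = cA v) \<and> proper_on (D \<union> E `` D) d"
    if DM: "D \<in> M" for D
  proof -
    obtain T where T: "T \<subseteq> A" "E `` D \<subseteq> D \<union> T" "extendable L T D" and AD: "A \<inter> D = {}"
      using D[OF DM] by blast
    have "proper_on T cA" using cA T(1) unfolding proper_on_def by blast
    then obtain d where d: "\<forall>v \<in> T. d v = cA v" "\<forall>v \<in> D - T. d v \<in> L v" "proper_on (D \<union> T) d"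
      using T(3) unfolding extendable_def by blast
    have "proper_on (D \<union> E `` D) d" using d(3) T(2) unfolding proper_on_def by blast
    moreover have "\<forall>v \<in> D. d v \<in> L v" using d(2) T(1) AD by blast
    moreover have "\<forall>v \<in> A \<inter> E `` D. d v = cA v" using d(1) T(2) AD by blast
    ultimately show ?thesis by blast
  qed
  then obtain d where d: "\<And>D. D \<in> M \<Longrightarrow> (\<forall>v \<in> D. d D v \<in> L v) \<and> (\<forall>v \<in> A \<inter> E `` D. d D v = cA v) \<and>
      proper_on (D \<union> E `` D) (d D)"
    by metis
  \<comment> \<open>Disjointness makes the piece containing \<open>v\<close> unique; outside
    \<open>A \<union> \<Union>M\<close> the value does not matter.\<close>
  define c where "c v = (if v \<in> A then cA v else d (THE D. D \<in> M \<and> v \<in> D) v)" for v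
  have c_A: "c v = cA v" if "v \<in> A" for v using that by (simp add: c_def)
  have c_D: "c v = d D v" if "D \<in> M" "v \<in> D" for v D
  proof -
    have "(THE D. D \<in> M \<and> v \<in> D) = D"
      by (rule the_equality) (use disj that in blast)+
    moreover have "v \<notin> A" using D that by blast
    ultimately show ?thesis by (simp add: c_def)
  qed
  have nb: "E `` D \<subseteq> D \<union> A" if "D \<in> M" for D using D[OF that] by blast
  have edge: "c x \<noteq> c y" if xy: "(x, y) \<in> E" "D \<in> M" "x \<in> D" for x y D
  proof -
    have y: "y \<in> E `` D" using xy by blast
    have "c y = d D y"
    proof (cases "y \<in> A")
      case True
      then show ?thesis using d[OF xy(2)] y c_A by auto
    next
      case False
      then show ?thesis using nb xy(2) y c_D by blast
    qed
    moreover have "d D x \<noteq> d D y" using d[OF xy(2)] xy y unfolding proper_on_def by blast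
    ultimately show ?thesis using c_D xy by simp
  qed
  have "proper_on (A \<union> \<Union>M) c"
    unfolding proper_on_def
  proof (intro ballI impI)
    fix x y assume xy: "x \<in> A \<union> \<Union>M" "y \<in> A \<union> \<Union>M" "(x, y) \<in> E"
    show "c x \<noteq> c y"
    proof (cases "x \<in> \<Union>M \<or> y \<in> \<Union>M")
      case True
      then show ?thesis using edge xy(3) E_symD by (metis UnionE)
    next
      case False
      then show ?thesis using xy cA c_A unfolding proper_on_def by auto
    qed
  qed
  moreover have "\<forall>v \<in> \<Union>M. c v \<in> L v" using d c_D by auto
  ultimately show thesis using that c_A by blast
qed

section \<open>Recursion through fragments and the resulting list sizes\<close>

lemma comp_nbrs: "E `` comp_of S x \<subseteq> comp_of S x \<union> S"
  using comp_closed by blast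

lemma fragment_extendable:
  assumes parts: "\<And>A S. tight_part A \<Longrightarrow> single S \<Longrightarrow> S \<subseteq> A \<Longrightarrow> extendable L S A"
    and "single S" and "x \<in> V - S"
  shows "extendable L S (comp_of S x)"
  using assms(2,3)
proof (induct "card (comp_of S x)" arbitrary: S x rule: less_induct)
  case less
  let ?C = "comp_of S x"
  obtain A M where A: "tight_part A" "S \<subseteq> A" "?C \<union> S = A \<union> \<Union>M" "A \<inter> \<Union>M = {}"
    and disj: "\<And>D D'. D \<in> M \<Longrightarrow> D' \<in> M \<Longrightarrow> D \<noteq> D' \<Longrightarrow> D \<inter> D' = {}"
    and M: "\<And>D. D \<in> M \<Longrightarrow> D \<subset> ?C \<and> (\<exists>T y. single T \<and> T \<subseteq> A \<and> y \<in> V - T \<and> D = comp_of T y)"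
    by (rule fragment_decomposition[OF less.prems]) blast
  show ?case
    unfolding extendable_def
  proof (intro allI impI)
    fix c assume "proper_on S c"
    then obtain cA where cA: "\<forall>v \<in> S. cA v = c v" "\<forall>v \<in> A - S. cA v \<in> L v" "proper_on (A \<union> S) cA"
      using parts A less.prems unfolding extendable_def by metis
    then have "proper_on A cA" using A(2) by (simp add: Un_absorb2)
    then obtain c' where c': "proper_on (A \<union> \<Union>M) c'" "\<forall>v \<in> A. c' v = cA v" "\<forall>v \<in> \<Union>M. c' v \<in> L v"
    proof (rule glue_colorings[OF _ disj])
      fix D assume D: "D \<in> M"
      then obtain T y where T: "single T" "T \<subseteq> A" "y \<in> V - T" "D = comp_of T y" "D \<subset> ?C"
        using M by metis
      then have "card (comp_of T y) < card ?C" using psubset_card_mono[OF finite_comp] by metis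
      then have "extendable L T D" using less.hyps T(1,3,4) by simp
      moreover have "E `` D \<subseteq> D \<union> T" using comp_nbrs T(4) by simp
      moreover have "A \<inter> D = {}" using A(4) D by blast
      ultimately show "A \<inter> D = {} \<and> (\<exists>T \<subseteq> A. E `` D \<subseteq> D \<union> T \<and> extendable L T D)"
        using T(2) by metis
    qed
    moreover have "\<forall>v \<in> S. c' v = c v" using c' cA A(2) by auto
    moreover have "c' v \<in> L v" if "v \<in> ?C - S" for v
    proof (cases "v \<in> A")
      case True
      then show ?thesis using cA(2) c'(2) that by auto
    next
      case False
      then show ?thesis using c'(3) A(3) that by blast
    qed
    ultimately show "\<exists>c'. (\<forall>v \<in> S. c' v = c v) \<and> (\<forall>v \<in> ?C - S. c' v \<in> L v) \<and> proper_on (?C \<union> S) c'"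
      using A(3) by auto
  qed
qed

text \<open>The recursion starts from a single cutset, whose two vertices need two colors each. The
  alternative \<open>S = {}\<close> serves a graph without single cutsets, where \<open>V\<close>
  itself is a part and nothing is precolored.\<close>

lemma colorable_from_parts:
  assumes parts: "\<And>A S. tight_part A \<Longrightarrow> single S \<or> S = {} \<Longrightarrow> S \<subseteq> A \<Longrightarrow> extendable L S A"
    and L: "\<forall>v \<in> V. finite (L v) \<and> 2 \<le> card (L v)"
  shows "\<exists>c. (\<forall>v \<in> V. c v \<in> L v) \<and> proper_on V c"
proof (cases "\<exists>S. single S")
  case True
  then obtain S where S: "single S" by blast
  have SV: "S \<subseteq> V" using S singleD(1) cutD by blast
  have "extendable L {} S"
  proof (rule greedy_extendable)
    show "finite S" using S singleD(1) finite_cut by blast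
    have "card (E `` {v} \<inter> S) < card S" if "v \<in> S" for v
      using that irrefl_E \<open>finite S\<close> by (intro psubset_card_mono) auto
    then show "\<forall>v \<in> S. finite (L v) \<and> card (E `` {v} \<inter> (S \<union> {})) < card (L v)"
      using L SV cutD(2)[OF singleD(1)[OF S]] by (metis less_le_trans subsetD sup_bot_right)
  qed
  then obtain cS where cS: "\<forall>v \<in> S. cS v \<in> L v" "proper_on S cS"
    unfolding extendable_def proper_on_def by auto
  let ?M = "comp_of S ` (V - S)"
  have V: "V = S \<union> \<Union>?M" using SV comp_self comp_subset by blast
  obtain c where "proper_on (S \<union> \<Union>?M) c" "\<forall>v \<in> S. c v = cS v" "\<forall>v \<in> \<Union>?M. c v \<in> L v"
  proof (rule glue_colorings[OF cS(2), of ?M L])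
    fix D D' assume "D \<in> ?M" "D' \<in> ?M" "D \<noteq> D'"
    then show "D \<inter> D' = {}" using comp_disjoint by blast
  next
    fix D assume "D \<in> ?M"
    then obtain x where x: "x \<in> V - S" "D = comp_of S x" by blast
    then have "extendable L S D" using fragment_extendable[OF parts S x(1)] by simp
    moreover have "E `` D \<subseteq> D \<union> S" using comp_nbrs x(2) by simp
    moreover have "S \<inter> D = {}" using x comp_subset by blast
    ultimately show "S \<inter> D = {} \<and> (\<exists>T \<subseteq> S. E `` D \<subseteq> D \<union> T \<and> extendable L T D)"
      by blast
  qed
  then show ?thesis using V cS(1) by (metis Un_iff)
next
  case False
  then have "extendable L {} V" using parts tight_part_verts by blast
  then show ?thesis unfolding extendable_def proper_on_def by auto
qed

text \<open>Some \<open>k\<close> has to be feasible for the least one, the choice number, to be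
  attained.\<close>

lemma list_colorable_card: "A \<subseteq> V \<Longrightarrow> list_colorable A (card A)"
  unfolding list_colorable_def
proof (intro allI impI)
  fix L :: "'a \<Rightarrow> nat set"
  assume AV: "A \<subseteq> V" and L: "\<forall>v \<in> A. finite (L v) \<and> card (L v) = card A"
  have "finite A" using AV finite_V finite_subset by blast
  moreover have "card (E `` {v} \<inter> A) < card A" if "v \<in> A" for v
    using that irrefl_E \<open>finite A\<close> by (intro psubset_card_mono) auto
  ultimately have "extendable L {} A" using L by (intro greedy_extendable) auto
  then show "\<exists>c. (\<forall>v \<in> A. c v \<in> L v) \<and> proper_on A c"
    unfolding extendable_def proper_on_def by auto
qed

text \<open>The two alternatives are the two ways to extend from \<open>S\<close>: deleting its at
  most two colors from the lists, or coloring greedily with one color more than the degree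
  bound.\<close>

lemma list_colorable_from_parts:
  assumes parts: "\<And>A. tight_part A \<Longrightarrow>
      (\<exists>k. list_colorable A k \<and> k + 2 \<le> m) \<or> 3 \<le> m \<and> (\<forall>v \<in> A. card (E `` {v} \<inter> A) \<le> 2)"
  shows "list_colorable V m"
  unfolding list_colorable_def
proof (intro allI impI)
  fix L :: "'a \<Rightarrow> nat set"
  assume L: "\<forall>v \<in> V. finite (L v) \<and> card (L v) = m"
  show "\<exists>c. (\<forall>v \<in> V. c v \<in> L v) \<and> proper_on V c"
  proof (rule colorable_from_parts)
    obtain A where "tight_part A" using ex_tight_part by blast
    then have "2 \<le> m" using parts by fastforce
    then show "\<forall>v \<in> V. finite (L v) \<and> 2 \<le> card (L v)" using L by simp
  next
    fix A S assume A: "tight_part A" and S: "single S \<or> S = {}" "S \<subseteq> A"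
    have AV: "A \<subseteq> V" using A tight_part_def by blast
    have LA: "\<forall>v \<in> A. finite (L v) \<and> card (L v) = m" using L AV by blast
    from parts[OF A] show "extendable L S A"
    proof
      assume "\<exists>k. list_colorable A k \<and> k + 2 \<le> m"
      then obtain k where "list_colorable A k" "k + 2 \<le> m" by blast
      moreover have "finite S" "card S \<le> 2"
        using S(1) singleD(1)[of S] cutD(2)[of S] finite_cut[of S] by auto
      ultimately show ?thesis using LA by (intro list_colorable_extendable) auto
    next
      assume "3 \<le> m \<and> (\<forall>v \<in> A. card (E `` {v} \<inter> A) \<le> 2)"
      moreover have "A \<union> S = A" using S by blast
      moreover have "finite A" using AV finite_V finite_subset by blast
      ultimately show ?thesis using LA by (intro greedy_extendable) fastforce+
    qed
  qed
qed

end

section \<open>Translation to the graph library\<close>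

lemma rtrancl_on_restrict: "rtrancl_on F (r \<inter> F \<times> F) = rtrancl_on F r"
proof (rule set_eqI, unfold split_paired_all, rule iffI)
  fix x y assume "(x, y) \<in> rtrancl_on F r"
  then show "(x, y) \<in> rtrancl_on F (r \<inter> F \<times> F)"
    by (induct rule: rtrancl_on_induct) (auto intro: rtrancl_on_into_rtrancl_on)
qed (auto intro: rtrancl_on_mono[of "r \<inter> F \<times> F"])

lemma symcl_sym: "sym r \<Longrightarrow> symcl r = r"
  by (auto simp: symcl_def dest: symD)

lemma arcs_ends_induce: "arcs_ends (with_proj P \<restriction> W) = parcs P \<inter> W \<times> W"
  by (force simp: arcs_ends_conv)

lemma connected_induce:
  assumes "sym (parcs P)"
  shows "connected (with_proj P \<restriction> W) \<longleftrightarrow>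
    W \<noteq> {} \<and> (\<forall>u \<in> W. \<forall>v \<in> W. (u, v) \<in> rtrancl_on W (parcs P))"
proof -
  have "sym (parcs P \<inter> W \<times> W)" using assms by (auto simp: sym_def)
  then show ?thesis
    by (simp add: connected_conv arcs_ends_induce symcl_sym rtrancl_on_restrict)
qed

lemma induce_induce: "W \<subseteq> A \<Longrightarrow> (H \<restriction> A) \<restriction> W = H \<restriction> W"
  by (auto simp: induce_subgraph_def)

text \<open>\<open>connected\<close> fails on the empty graph, but \<open>cutset\<close> excludes
  deleting every vertex; so a failure of connectedness always means two separated vertices.\<close>

lemma cutset_induce:
  assumes "sym (parcs P)"
  shows "cutset (with_proj P \<restriction> A) R \<longleftrightarrow>
    R \<subseteq> A \<and> (\<exists>x \<in> A - R. \<exists>y \<in> A - R. (x, y) \<notin> rtrancl_on (A - R) (parcs P))"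
  unfolding cutset_def del_vertices_def
  by (auto simp: induce_induce connected_induce[OF assms])

lemma choosable_induce:
  fixes A :: "'a set"
  shows "choosable (with_proj P \<restriction> A) k \<longleftrightarrow>
    (\<forall>L :: 'a \<Rightarrow> nat set. (\<forall>v \<in> A. finite (L v) \<and> card (L v) = k) \<longrightarrow>
      (\<exists>c. (\<forall>v \<in> A. c v \<in> L v) \<and> (\<forall>x \<in> A. \<forall>y \<in> A. (x, y) \<in> parcs P \<longrightarrow> c x \<noteq> c y)))"
proof -
  have "proper_coloring (with_proj P \<restriction> A) c \<longleftrightarrow> (\<forall>x \<in> A. \<forall>y \<in> A. (x, y) \<in> parcs P \<longrightarrow> c x \<noteq> c y)"
    for c :: "'a \<Rightarrow> nat"
    unfolding proper_coloring_def by fastforce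
  then show ?thesis unfolding choosable_def by simp
qed

text \<open>Maximality ranges over arbitrary subgraphs. A connected one through \<open>x\<close> is
  contained in the graph induced on the vertices reachable from \<open>x\<close>, so these induced
  graphs are the maximal ones.\<close>

lemma (in pair_sym_digraph) components_induce:
  assumes "W \<subseteq> pverts G"
  shows "components (with_proj G \<restriction> W) = (\<lambda>x. {y. (x, y) \<in> rtrancl_on W (parcs G)}) ` W"
proof -
  let ?H = "with_proj G \<restriction> W" and ?comp = "\<lambda>x. {y. (x, y) \<in> rtrancl_on W (parcs G)}"
  have sym: "sym (parcs G)" using pair_sym_arcs by (simp add: symmetric_def)
  interpret H: wf_digraph ?H by (rule wellformed_induce_subgraph)
  have comp_sub: "?comp x \<subseteq> W" for x by (auto dest: in_rtrancl_on_in_F)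
  have in_comp: "(x, y) \<in> rtrancl_on (?comp x) (parcs G)" if "(x, y) \<in> rtrancl_on W (parcs G)" for x y
    using that
    by (induct rule: rtrancl_on_induct) (auto intro: rtrancl_on_into_rtrancl_on)
  have conn: "connected (with_proj G \<restriction> ?comp x)" if "x \<in> W" for x
  proof -
    have "(u, v) \<in> rtrancl_on (?comp x) (parcs G)" if "u \<in> ?comp x" "v \<in> ?comp x" for u v
    proof (rule rtrancl_on_trans)
      show "(u, x) \<in> rtrancl_on (?comp x) (parcs G)"
        by (rule symD[OF rtrancl_on_sym[OF sym] in_comp]) (use that in simp)
      show "(x, v) \<in> rtrancl_on (?comp x) (parcs G)"
        by (rule in_comp) (use that in simp)
    qed
    then show ?thesis using \<open>x \<in> W\<close> by (auto simp: connected_induce[OF sym])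
  qed
  have sub: "subgraph (with_proj G \<restriction> ?comp x) ?H" for x
  proof (rule subgraphI)
    show "wf_digraph (with_proj G \<restriction> ?comp x)" by (rule wellformed_induce_subgraph)
  qed (use comp_sub in \<open>auto simp: compatible_def intro: H.wf_digraph\<close>)
  have inside: "subgraph H' (with_proj G \<restriction> ?comp x)"
    if H': "subgraph H' ?H" "connected H'" and x: "x \<in> verts H'" for H' x
  proof -
    have "(u, v) \<in> rtrancl_on W (parcs G)" if "u \<in> verts H'" "v \<in> verts H'" for u v
    proof (rule rtrancl_on_mono)
      show "(u, v) \<in> rtrancl_on (verts H') ((arcs_ends H')\<^sup>s)"
        using H'(2) that by (simp add: connected_conv)
      have "arcs_ends H' \<subseteq> parcs G" using arcs_ends_mono[OF H'(1)] by (auto simp: arcs_ends_induce)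
      then show "(arcs_ends H')\<^sup>s \<subseteq> parcs G" using sym by (auto simp: symcl_def dest: symD)
      show "verts H' \<subseteq> W" using subgraph_imp_subverts[OF H'(1)] by simp
    qed
    then have V: "verts H' \<subseteq> ?comp x" using x by blast
    show ?thesis
    proof (rule subgraphI)
      show "arcs H' \<subseteq> arcs (with_proj G \<restriction> ?comp x)"
      proof
        fix e assume e: "e \<in> arcs H'"
        have c: "tail H' = fst" "head H' = snd" "arcs H' \<subseteq> parcs G"
          using H'(1) by (auto simp: subgraph_def compatible_def)
        have "tail H' e \<in> verts H'" "head H' e \<in> verts H'"
          using H'(1) e by (auto simp: subgraph_def wf_digraph.wellformed)
        then show "e \<in> arcs (with_proj G \<restriction> ?comp x)" using V c e by auto
      qed
      show "wf_digraph (with_proj G \<restriction> ?comp x)" by (rule wellformed_induce_subgraph)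
    qed (use V H'(1) in \<open>auto simp: subgraph_def compatible_def\<close>)
  qed
  \<comment> \<open>Compatibility fixes the tail and head functions too, so mutual subgraphs are
    equal as records.\<close>
  have antisym: "H1 = H2" if "subgraph H1 H2" "subgraph H2 H1" for H1 H2 :: "('a, 'a \<times> 'a) pre_digraph"
    using that by (auto simp: subgraph_def compatible_def)
  have max: "pre_digraph.max_subgraph ?H connected (with_proj G \<restriction> ?comp x)" if x: "x \<in> W" for x
    unfolding pre_digraph.max_subgraph_def
  proof (intro conjI allI impI notI)
    fix H' assume *: "H' \<noteq> with_proj G \<restriction> ?comp x \<and> subgraph (with_proj G \<restriction> ?comp x) H'"
      "subgraph H' ?H \<and> connected H'"
    then have "x \<in> verts H'" using x by (auto simp: subgraph_def)
    then show False using * inside antisym by blast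
  qed (use sub conn x in auto)
  show ?thesis
  proof
    show "components ?H \<subseteq> ?comp ` W"
    proof
      fix C assume "C \<in> components ?H"
      then obtain H' where H': "C = verts H'" "pre_digraph.max_subgraph ?H connected H'"
        unfolding components_def by blast
      then have sub': "subgraph H' ?H" "connected H'" by (auto simp: pre_digraph.max_subgraph_def)
      then obtain x where x: "x \<in> verts H'" by (auto simp: connected_conv)
      then have xW: "x \<in> W" using sub' by (auto simp: subgraph_def)
      have "H' = with_proj G \<restriction> ?comp x"
        using pre_digraph.max_subgraph_subg_eq[OF H'(2) max[OF xW]] inside sub' x by blast
      then show "C \<in> ?comp ` W" using H'(1) xW by auto
    qed
    show "?comp ` W \<subseteq> components ?H"
      unfolding components_def using max by (force intro: rev_image_eqI)
  qed
qed

section \<open>Dictionary between the graph notions and the arc relation\<close>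

context
  fixes G :: "'a pair_pre_digraph"
  assumes graph: "pair_graph G" and biconn: "k_connected 2 (with_proj G)"
begin

interpretation pair_graph G by (rule graph)

lemma with_proj_induce_verts: "with_proj G \<restriction> pverts G = with_proj G"
  by (auto simp: induce_subgraph_def with_proj_def dest: in_arcsD1 in_arcsD2)

lemma sym_parcs: "sym (parcs G)"
  using pair_sym_arcs by (simp add: symmetric_def)

lemma cutset_conv:
  "cutset (with_proj G) R \<longleftrightarrow> R \<subseteq> pverts G \<and>
    (\<exists>x \<in> pverts G - R. \<exists>y \<in> pverts G - R. (x, y) \<notin> rtrancl_on (pverts G - R) (parcs G))"
  using cutset_induce[OF sym_parcs, of "pverts G"] by (simp add: with_proj_induce_verts)

interpretation B: biconnected_rel "pverts G" "parcs G"
proof unfold_locales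
  show "finite (pverts G)" by (rule pair_finite_verts)
  show "sym (parcs G)" by (rule sym_parcs)
  show "(x, x) \<notin> parcs G" for x using no_loops' by blast
  show "parcs G \<subseteq> pverts G \<times> pverts G" by (auto dest: in_arcsD1 in_arcsD2)
  show "(x, y) \<in> rtrancl_on (pverts G - R) (parcs G)"
    if "R \<subseteq> pverts G" "card R < 2" "x \<in> pverts G - R" "y \<in> pverts G - R" for R x y
    using biconn that unfolding k_connected_def cutset_conv by blast
qed

lemma two_cutsets_conv: "R \<in> two_cutsets (with_proj G) \<longleftrightarrow> B.cut R"
  unfolding two_cutsets_def B.cut_def cutset_conv B.reach_def by auto

lemma components_conv:
  "components (del_vertices (with_proj G) R) = B.comp_of R ` (pverts G - R)"
  unfolding del_vertices_def B.comp_of_def B.reach_def by (simp add: components_induce)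

lemma splits_conv:
  assumes "B.cut R" and "X \<subseteq> pverts G"
  shows "splits (with_proj G) R X \<longleftrightarrow> B.splitting R X"
proof
  assume s: "splits (with_proj G) R X"
  show "B.splitting R X"
  proof (rule ccontr)
    assume n: "\<not> B.splitting R X"
    \<comment> \<open>If \<open>X \<subseteq> R\<close>, every component contains the empty set
      \<open>X - R\<close>, so any vertex outside \<open>R\<close> serves; a cutset leaves
      one.\<close>
    obtain x where x: "x \<in> pverts G - R" "X - R = {} \<or> x \<in> X - R"
      using assms unfolding B.cut_def by blast
    then have "X - R \<subseteq> B.comp_of R x"
      using n unfolding B.splitting_def B.comp_of_def by auto
    then show False using s x(1) unfolding splits_def components_conv by blast
  qed
next
  assume "B.splitting R X"
  then show "splits (with_proj G) R X"
    unfolding splits_def components_conv B.splitting_def B.comp_of_def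
    using B.reach_sym B.reach_trans by blast
qed

lemma single_cutsets_conv: "S \<in> single_cutsets (with_proj G) \<longleftrightarrow> B.single S"
proof -
  have "\<not> B.splitting S S" unfolding B.splitting_def by blast
  moreover have "splits (with_proj G) S T = B.splitting S T" "splits (with_proj G) T S = B.splitting T S"
    if "B.cut S" "B.cut T" for T
    using that splits_conv B.cutD(1) by blast+
  ultimately show ?thesis
    unfolding single_cutsets_def B.single_def independent_cutsets_def mem_Collect_eq Ball_def two_cutsets_conv
    by metis
qed

lemma tight_part_in_parts:
  assumes "B.tight_part A"
  shows "A \<in> parts (with_proj G)"
proof -
  have A: "A \<subseteq> pverts G" "\<And>R. B.single R \<Longrightarrow> \<not> B.splitting R A"
    "\<And>x. x \<in> pverts G - A \<Longrightarrow> \<exists>R. B.single R \<and> R \<subseteq> A \<and> \<not> A \<subseteq> R \<and> x \<notin> R \<and> B.comp_of R x \<inter> A = {}"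
    using assms unfolding B.tight_part_def by auto
  have "separates (with_proj G) R {x} A"
    if "x \<in> pverts G" "x \<notin> R" "\<not> A \<subseteq> R" "B.comp_of R x \<inter> A = {}" for R x
    using that B.comp_eq unfolding separates_def components_conv by blast
  then have "\<exists>R \<in> single_cutsets (with_proj G). separates (with_proj G) R {x} A"
    if "x \<in> pverts G - A" for x
    using A(3)[OF that] that single_cutsets_conv by blast
  moreover have "\<not> splits (with_proj G) R A" if "R \<in> single_cutsets (with_proj G)" for R
    using that A(1,2) splits_conv B.singleD(1) single_cutsets_conv by blast
  ultimately show ?thesis unfolding parts_def using A(1) by simp
qed

text \<open>A vertex with three neighbors in \<open>A\<close> gives \<open>A\<close> at least four
  vertices, as triconnectedness requires, and rules out small cutsets of G'(A) by the degree bound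
  for non-blocks.\<close>

lemma tight_part_block:
  assumes A: "B.tight_part A" and deg: "\<not> (\<forall>v \<in> A. card (parcs G `` {v} \<inter> A) \<le> 2)"
  shows "A \<in> blocks G"
proof -
  let ?E = "parcs (add_single_edges G)"
  have E: "?E = parcs G \<union> {(a, b). B.single {a, b}}"
    unfolding add_single_edges_def by (simp add: single_cutsets_conv)
  have symE: "sym ?E" unfolding E using sym_parcs by (auto simp: sym_def insert_commute)
  have AV: "A \<subseteq> pverts G" using A B.tight_part_def by blast
  then have finA: "finite A" using pair_finite_verts finite_subset by blast
  obtain v where v: "v \<in> A" "\<not> card (parcs G `` {v} \<inter> A) \<le> 2" using deg by blast
  have "card (parcs G `` {v} \<inter> A) < card A"
    using v finA B.irrefl_E by (intro psubset_card_mono) auto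
  then have "3 < card A" using v by simp
  moreover have "\<not> card R < 3" if R: "cutset (with_proj (add_single_edges G) \<restriction> A) R" for R
  proof
    assume R3: "card R < 3"
    obtain x y where xy: "R \<subseteq> A" "x \<in> A - R" "y \<in> A - R" "(x, y) \<notin> rtrancl_on (A - R) ?E"
      using R unfolding cutset_induce[OF symE] by blast
    have "B.part_edges A \<subseteq> ?E" unfolding B.part_edges_def E by auto
    then have "\<not> B.part_reach A R x y"
      using xy(4) unfolding B.part_reach_def by (meson order_refl rtrancl_on_mono)
    then show False using B.non_block_degree A xy R3 v by blast
  qed
  ultimately have "k_connected 3 (with_proj (add_single_edges G) \<restriction> A)"
    unfolding k_connected_def by auto
  then show ?thesis unfolding blocks_def using tight_part_in_parts A by blast
qed

section \<open>Choice numbers and their maximum\<close>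

lemma choosable_conv: "choosable (with_proj G \<restriction> A) k \<longleftrightarrow> B.list_colorable A k"
  unfolding choosable_induce B.list_colorable_def B.proper_on_def by (rule refl)

lemma list_colorable_choice_number:
  assumes "A \<subseteq> pverts G"
  shows "B.list_colorable A (choice_number (with_proj G \<restriction> A))"
  unfolding choice_number_def choosable_conv[symmetric]
  by (rule LeastI[of _ "card A"]) (simp add: choosable_conv B.list_colorable_card assms)

lemma choice_number_le: "B.list_colorable (pverts G) m \<Longrightarrow> choice_number (with_proj G) \<le> m"
  unfolding choice_number_def
  using choosable_conv[of "pverts G"] by (auto simp: with_proj_induce_verts intro: Least_le)

lemma finite_parts: "finite (parts (with_proj G))"
  by (rule finite_subset[of _ "Pow (pverts G)"]) (auto simp: parts_def pair_finite_verts)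

text \<open>A finite nonempty family attains its supremum, which provides a natural number usable as
  a list size.\<close>

lemma max_choice_number_attained:
  assumes "\<A> \<subseteq> parts (with_proj G)" and "\<A> \<noteq> {}"
  obtains m where "ereal (real m) \<le> max_choice_number (with_proj G) \<A>"
    and "\<And>A. A \<in> \<A> \<Longrightarrow> choice_number (with_proj G \<restriction> A) \<le> m"
proof -
  let ?f = "\<lambda>A. choice_number (with_proj G \<restriction> A)"
  have fin: "finite (?f ` \<A>)" using assms(1) finite_parts finite_subset by blast
  then have "Max (?f ` \<A>) \<in> ?f ` \<A>" using assms(2) by (intro Max_in) auto
  then have "ereal (real (Max (?f ` \<A>))) \<le> max_choice_number (with_proj G) \<A>"
    unfolding max_choice_number_def by (auto intro: SUP_upper2)
  then show thesis using that fin by simp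
qed

lemma choice_number_le_parts:
  "ereal (real (choice_number (with_proj G)))
     \<le> max_choice_number (with_proj G) (parts (with_proj G)) + 2"
proof -
  have "parts (with_proj G) \<noteq> {}" using B.ex_tight_part tight_part_in_parts by blast
  then obtain m where m: "ereal (real m) \<le> max_choice_number (with_proj G) (parts (with_proj G))"
    "\<And>A. A \<in> parts (with_proj G) \<Longrightarrow> choice_number (with_proj G \<restriction> A) \<le> m"
    using max_choice_number_attained by blast
  have "B.list_colorable (pverts G) (m + 2)"
  proof (rule B.list_colorable_from_parts, rule disjI1)
    fix A assume A: "B.tight_part A"
    then have "A \<subseteq> pverts G" using B.tight_part_def by blast
    then show "\<exists>k. B.list_colorable A k \<and> k + 2 \<le> m + 2"
      using list_colorable_choice_number m(2)[OF tight_part_in_parts[OF A]] by auto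
  qed
  then have "ereal (real (choice_number (with_proj G))) \<le> ereal (real m) + 2"
    using choice_number_le by fastforce
  also have "\<dots> \<le> max_choice_number (with_proj G) (parts (with_proj G)) + 2"
    using m(1) by (rule add_right_mono)
  finally show ?thesis .
qed

lemma choice_number_le_blocks:
  "ereal (real (choice_number (with_proj G)))
     \<le> max 3 (max_choice_number (with_proj G) (blocks G) + 2)"
proof -
  have "\<exists>m. ereal (real m) \<le> max 3 (max_choice_number (with_proj G) (blocks G) + 2) \<and> 3 \<le> m \<and>
      (\<forall>A \<in> blocks G. choice_number (with_proj G \<restriction> A) + 2 \<le> m)"
  proof (cases "blocks G = {}")
    case True
    \<comment> \<open>Without blocks the inner maximum is \<open>-\<infinity>\<close> and remains so
      after adding 2; the bound is 3.\<close>
    then show ?thesis by (intro exI[of _ 3]) auto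
  next
    case False
    moreover have "blocks G \<subseteq> parts (with_proj G)" unfolding blocks_def by blast
    ultimately obtain m where m: "ereal (real m) \<le> max_choice_number (with_proj G) (blocks G)"
      "\<And>A. A \<in> blocks G \<Longrightarrow> choice_number (with_proj G \<restriction> A) \<le> m"
      using max_choice_number_attained by blast
    have "ereal (real m) + 2 \<le> max_choice_number (with_proj G) (blocks G) + 2"
      using m(1) by (rule add_right_mono)
    then have "max 3 (ereal (real m) + 2) \<le> max 3 (max_choice_number (with_proj G) (blocks G) + 2)"
      by (intro max.mono order_refl)
    moreover have "ereal (real (max 3 (m + 2))) = max 3 (ereal (real m) + 2)"
      by (simp add: max_def)
    ultimately have "ereal (real (max 3 (m + 2))) \<le> max 3 (max_choice_number (with_proj G) (blocks G) + 2)"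
      by (simp only:)
    moreover have "\<forall>A \<in> blocks G. choice_number (with_proj G \<restriction> A) + 2 \<le> max 3 (m + 2)"
      using m(2) by (simp add: le_max_iff_disj)
    ultimately show ?thesis by (intro exI[of _ "max 3 (m + 2)"] conjI max.cobounded1)
  qed
  then obtain m where m: "ereal (real m) \<le> max 3 (max_choice_number (with_proj G) (blocks G) + 2)"
    "3 \<le> m" "\<And>A. A \<in> blocks G \<Longrightarrow> choice_number (with_proj G \<restriction> A) + 2 \<le> m"
    by blast
  have "B.list_colorable (pverts G) m"
  proof (rule B.list_colorable_from_parts)
    fix A assume A: "B.tight_part A"
    then have "A \<subseteq> pverts G" using B.tight_part_def by blast
    then show "(\<exists>k. B.list_colorable A k \<and> k + 2 \<le> m) \<or>
        3 \<le> m \<and> (\<forall>v \<in> A. card (parcs G `` {v} \<inter> A) \<le> 2)"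
      \<comment> \<open>A part violating the degree bound is a block, so \<open>m\<close> exceeds
        its choice number by at least two.\<close>
      using list_colorable_choice_number m tight_part_block[OF A] by blast
  qed
  then have "ereal (real (choice_number (with_proj G))) \<le> ereal (real m)"
    using choice_number_le by simp
  with m(1) show ?thesis by (rule order_trans[rotated])
qed

end

theorem theorem5:
  fixes G :: "'a pair_pre_digraph"
  assumes "pair_graph G"
    and "k_connected 2 (with_proj G)"
  shows "ereal (real (choice_number (with_proj G)))
           \<le> max_choice_number (with_proj G) (parts (with_proj G)) + 2 \<and>
         ereal (real (choice_number (with_proj G)))
           \<le> max 3 (max_choice_number (with_proj G) (blocks G) + 2)"
  using choice_number_le_parts choice_number_le_blocks assms by blast

end
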